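(* Suppose $p\neq2$ and let $\alpha,\beta,\gamma\in\widehat{\mathbb{F}_q^\times}$ with $\beta^2\neq\varepsilon$. Then for $x\in\mathbb{F}_q$ and $y\in\mathbb{F}_q\setminus\{\pm1\}$, $$F_4\!\left({\alpha;\alpha\overline{\beta}\phi\atop\gamma,\beta\phi};x,y^2\right)=\overline{\alpha}^2(1+y)\,F_2\!\left({\alpha;\alpha\overline{\beta}\phi,\beta\atop\gamma,\beta^2};\frac{x}{(1+y)^2},\frac{4y}{(1+y)^2}\right).$$
   Context: $\mathbb{F}_q$ is a finite field with $q$ elements and characteristic $p$. $\widehat{\mathbb{F}_q^\times}$ is the group of multiplicative characters $\mathbb{F}_q^\times\to\overline{\mathbb{Q}}^\times$, $\varepsilon$ the trivial character, $\phi$ the quadratic character; every character (including $\varepsilon$) is extended by $0$ at $0$; $\overline{\eta}=\eta^{-1}$; $\delta(\eta)=1$ if $\eta=\varepsilon$, else $0$. $\psi$ is a fixed non-trivial additive character. $g(\eta)=-\sum_{x\in\mathbb{F}_q^\times}\psi(x)\eta(x)$, $g^\circ(\eta)=q^{\delta(\eta)}g(\eta)$, $(\alpha)_\nu=g(\alpha\nu)/g(\alpha)$, $(\alpha)^\circ_\nu=g^\circ(\alpha\nu)/g^\circ(\alpha)$. Appell's functions: for $x,y\in\mathbb{F}_q$, with sums over $\nu_1,\nu_2\in\widehat{\mathbb{F}_q^\times}$, $F_2\!\left({\alpha;\beta_1,\beta_2\atop\gamma_1,\gamma_2};x,y\right)=\frac{1}{(1-q)^2}\sum\frac{(\alpha)_{\nu_1\nu_2}(\beta_1)_{\nu_1}(\beta_2)_{\nu_2}}{(\gamma_1)^\circ_{\nu_1}(\gamma_2)^\circ_{\nu_2}(\varepsilon)^\circ_{\nu_1}(\varepsilon)^\circ_{\nu_2}}\nu_1(x)\nu_2(y)$,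 $F_4\!\left({\alpha;\beta\atop\gamma_1,\gamma_2};x,y\right)=\frac{1}{(1-q)^2}\sum\frac{(\alpha)_{\nu_1\nu_2}(\beta)_{\nu_1\nu_2}}{(\gamma_1)^\circ_{\nu_1}(\gamma_2)^\circ_{\nu_2}(\varepsilon)^\circ_{\nu_1}(\varepsilon)^\circ_{\nu_2}}\nu_1(x)\nu_2(y)$. *)

theory Defs
  imports Complex_Main
begin

definition mult_chars :: "('a::{finite,field} \<Rightarrow> complex) set" where
  "mult_chars = {\<chi>. \<chi> 0 = 0 \<and> (\<forall>x. x \<noteq> 0 \<longrightarrow> \<chi> x \<noteq> 0)
      \<and> \<chi> 1 = 1 \<and> (\<forall>x y. \<chi> (x * y) = \<chi> x * \<chi> y)}"

definition triv_char :: "'a::{finite,field} \<Rightarrow> complex" where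
  "triv_char x = (if x = 0 then 0 else 1)"

definition quad_char :: "'a::{finite,field} \<Rightarrow> complex" where
  "quad_char x = (if x = 0 then 0 else if (\<exists>z. x = z * z) then 1 else -1)"

definition char_mult :: "('a::{finite,field} \<Rightarrow> complex) \<Rightarrow> ('a \<Rightarrow> complex) \<Rightarrow> ('a \<Rightarrow> complex)" where
  "char_mult \<chi> \<eta> = (\<lambda>x. \<chi> x * \<eta> x)"

definition char_inv :: "('a::{finite,field} \<Rightarrow> complex) \<Rightarrow> ('a \<Rightarrow> complex)" where
  "char_inv \<chi> = (\<lambda>x. if x = 0 then 0 else inverse (\<chi> x))"

definition add_char :: "('a::{finite,field} \<Rightarrow> complex) \<Rightarrow> bool" where
  "add_char \<psi> \<longleftrightarrow> (\<forall>x y. \<psi> (x + y) = \<psi> x * \<psi> y) \<and> \<psi> 0 = 1"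

definition nontriv_add_char :: "('a::{finite,field} \<Rightarrow> complex) \<Rightarrow> bool" where
  "nontriv_add_char \<psi> \<longleftrightarrow> add_char \<psi> \<and> (\<exists>x. \<psi> x \<noteq> 1)"

definition gauss :: "('a::{finite,field} \<Rightarrow> complex) \<Rightarrow> ('a \<Rightarrow> complex) \<Rightarrow> complex" where
  "gauss \<psi> \<eta> = - (\<Sum>x\<in>UNIV - {0}. \<psi> x * \<eta> x)"

definition gauss0 :: "('a::{finite,field} \<Rightarrow> complex) \<Rightarrow> ('a \<Rightarrow> complex) \<Rightarrow> complex" where
  "gauss0 \<psi> \<eta> = (if \<eta> = triv_char then of_nat (card (UNIV :: 'a set)) else 1) * gauss \<psi> \<eta>"

definition poch :: "('a::{finite,field} \<Rightarrow> complex) \<Rightarrow> ('a \<Rightarrow> complex) \<Rightarrow> ('a \<Rightarrow> complex) \<Rightarrow> complex" where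
  "poch \<psi> \<alpha> \<nu> = gauss \<psi> (char_mult \<alpha> \<nu>) / gauss \<psi> \<alpha>"

definition poch0 :: "('a::{finite,field} \<Rightarrow> complex) \<Rightarrow> ('a \<Rightarrow> complex) \<Rightarrow> ('a \<Rightarrow> complex) \<Rightarrow> complex" where
  "poch0 \<psi> \<alpha> \<nu> = gauss0 \<psi> (char_mult \<alpha> \<nu>) / gauss0 \<psi> \<alpha>"

definition appellF2 :: "('a::{finite,field} \<Rightarrow> complex) \<Rightarrow> ('a \<Rightarrow> complex) \<Rightarrow> ('a \<Rightarrow> complex) \<Rightarrow> ('a \<Rightarrow> complex)
    \<Rightarrow> ('a \<Rightarrow> complex) \<Rightarrow> ('a \<Rightarrow> complex) \<Rightarrow> 'a \<Rightarrow> 'a \<Rightarrow> complex" where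
  "appellF2 \<psi> \<alpha> \<beta>1 \<beta>2 \<gamma>1 \<gamma>2 x y =
     1 / (1 - of_nat (card (UNIV :: 'a set)))^2 *
     (\<Sum>\<nu>1\<in>mult_chars. \<Sum>\<nu>2\<in>mult_chars.
        poch \<psi> \<alpha> (char_mult \<nu>1 \<nu>2) * poch \<psi> \<beta>1 \<nu>1 * poch \<psi> \<beta>2 \<nu>2
        / (poch0 \<psi> \<gamma>1 \<nu>1 * poch0 \<psi> \<gamma>2 \<nu>2 * poch0 \<psi> triv_char \<nu>1 * poch0 \<psi> triv_char \<nu>2)
        * \<nu>1 x * \<nu>2 y)"

definition appellF4 :: "('a::{finite,field} \<Rightarrow> complex) \<Rightarrow> ('a \<Rightarrow> complex) \<Rightarrow> ('a \<Rightarrow> complex)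
    \<Rightarrow> ('a \<Rightarrow> complex) \<Rightarrow> ('a \<Rightarrow> complex) \<Rightarrow> 'a \<Rightarrow> 'a \<Rightarrow> complex" where
  "appellF4 \<psi> \<alpha> \<beta> \<gamma>1 \<gamma>2 x y =
     1 / (1 - of_nat (card (UNIV :: 'a set)))^2 *
     (\<Sum>\<nu>1\<in>mult_chars. \<Sum>\<nu>2\<in>mult_chars.
        poch \<psi> \<alpha> (char_mult \<nu>1 \<nu>2) * poch \<psi> \<beta> (char_mult \<nu>1 \<nu>2)
        / (poch0 \<psi> \<gamma>1 \<nu>1 * poch0 \<psi> \<gamma>2 \<nu>2 * poch0 \<psi> triv_char \<nu>1 * poch0 \<psi> triv_char \<nu>2)
        * \<nu>1 x * \<nu>2 y)"

end

theory Submission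
  imports Defs "HOL-Algebra.Multiplicative_Group" "HOL-Algebra.Algebraic_Closure_Type"
begin

text \<open>
  Fix the character \<open>\<nu>\<^sub>1\<close> and put \<open>A = \<alpha>\<nu>\<^sub>1\<close>. The theorem reduces to a quadratic transformation of the sums over
  \<open>\<nu>\<^sub>2\<close>. Since \<open>g\<degree>(\<eta>) g(\<eta>\<^sup>-\<^sup>1) = \<eta>(-1) q\<close>, each of them becomes, by orthogonality of characters, a triple sum
  over \<open>x\<^sub>1, x\<^sub>2, x\<^sub>3\<close> of \<open>\<psi>(x\<^sub>1 + x\<^sub>2 + x\<^sub>3 + x\<^sub>1x\<^sub>2z/x\<^sub>3)\<close> against three characters. Both triple sums are multiples of
  \<open>\<Sum> A(x) (\<beta>\<^sup>-\<^sup>1\<phi>)(v) \<psi>((x + v)(1 + xy\<^sup>2/v))\<close>: for F4 because a Kloosterman sum depends only on the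
  product of its two parameters (here the condition on y enters), for F2 by completing a square. The remaining
  constants agree by the Hasse-Davenport relation \<open>\<beta>(4) g(\<beta>) g(\<beta>\<phi>) = g(\<beta>\<^sup>2) g(\<phi>)\<close>.
\<close>

section \<open>The unit group of a finite field and its characters\<close>

text \<open>Cyclicity of the unit group is a theorem about rings with an explicit carrier;
  \<open>ring_of_type_algebra\<close> transports it to the type class. The exponent q - 1 comes from
  Lagrange's theorem.\<close>

lemma finite_field_generator:
  obtains h :: "'a::{finite,field}"
  where "h \<noteq> 0" "h ^ (card (UNIV :: 'a set) - 1) = 1" "\<And>x. x \<noteq> 0 \<Longrightarrow> \<exists>i. x = h ^ i"
proof -
  let ?R = "ring_of_type_algebra :: 'a ring"
  let ?M = "Multiplicative_Group.mult_of ?R"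
  interpret F: Ring.field ?R by (rule field_from_type_algebra)
  have pow: "x [^]\<^bsub>?R\<^esub> (i::nat) = x ^ i" for x :: 'a and i
    by (induction i) (simp_all add: ring_of_type_algebra_def)
  have car: "carrier ?M = UNIV - {0}" "carrier ?R = UNIV" and one: "\<one>\<^bsub>?R\<^esub> = 1"
    by (simp_all add: ring_of_type_algebra_def)
  have "\<exists>a\<in>UNIV - {0 :: 'a}. UNIV - {0} = {a ^ i | i::nat. i \<in> UNIV}"
    using F.finite_field_mult_group_has_gen[unfolded car pow] by simp
  then obtain h :: 'a where h: "h \<noteq> 0" and gen: "UNIV - {0} = {h ^ i | i::nat. i \<in> UNIV}"
    by blast
  have "h [^]\<^bsub>?M\<^esub> Coset.order ?M = \<one>\<^bsub>?M\<^esub>"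
    by (rule group.pow_order_eq_1[OF F.field_mult_group]) (simp only: car h, simp add: h)
  then have "h ^ (card (UNIV :: 'a set) - 1) = 1"
    by (simp only: Coset.order_def car Multiplicative_Group.nat_pow_mult_of pow one Multiplicative_Group.one_mult_of) simp
  with h gen show thesis
    by (intro that[of h]) auto
qed

lemma mult_charsD:
  assumes "\<chi> \<in> mult_chars"
  shows "\<chi> 0 = 0" "x \<noteq> 0 \<Longrightarrow> \<chi> x \<noteq> 0" "\<chi> 1 = 1" "\<chi> (x * y) = \<chi> x * \<chi> y"
  using assms by (simp_all add: mult_chars_def)

lemma mult_char_power: "\<chi> \<in> mult_chars \<Longrightarrow> \<chi> (x ^ n) = \<chi> x ^ n"
  by (induction n) (simp_all add: mult_charsD)

text \<open>The convention \<open>inverse 0 = 0\<close> agrees with the extension of characters by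
  0, so the identity holds on the whole field.\<close>

lemma mult_char_inverse: "\<chi> \<in> mult_chars \<Longrightarrow> \<chi> (inverse x) = inverse (\<chi> x)"
  by (cases "x = 0") (auto simp: mult_charsD(1,3) mult_charsD(4)[symmetric] intro!: inverse_unique[symmetric])

lemma mult_char_divide: "\<chi> \<in> mult_chars \<Longrightarrow> \<chi> (x / y) = \<chi> x / \<chi> y"
  by (simp add: field_class.field_divide_inverse mult_charsD(4) mult_char_inverse)

lemma mult_char_minus_one_square: "\<chi> \<in> mult_chars \<Longrightarrow> \<chi> (- 1) * \<chi> (- 1) = 1"
  by (simp add: mult_charsD(3) mult_charsD(4)[symmetric])

lemma char_inv_eq: "\<chi> \<in> mult_chars \<Longrightarrow> char_inv \<chi> x = inverse (\<chi> x)"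
  by (simp add: char_inv_def mult_charsD(1))

lemma triv_char_mem: "triv_char \<in> mult_chars"
  by (simp add: triv_char_def mult_chars_def)

lemma char_mult_mem: "\<chi> \<in> mult_chars \<Longrightarrow> \<eta> \<in> mult_chars \<Longrightarrow> char_mult \<chi> \<eta> \<in> mult_chars"
  by (simp add: char_mult_def mult_chars_def)

lemma char_inv_mem: "\<chi> \<in> mult_chars \<Longrightarrow> char_inv \<chi> \<in> mult_chars"
  by (auto simp: char_inv_def mult_chars_def)

lemma char_mult_commute: "char_mult \<chi> \<eta> = char_mult \<eta> \<chi>"
  by (simp add: char_mult_def mult.commute)

lemma char_mult_assoc: "char_mult (char_mult \<chi> \<eta>) \<theta> = char_mult \<chi> (char_mult \<eta> \<theta>)"
  by (simp add: char_mult_def mult.assoc)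

lemma char_mult_triv: "\<chi> \<in> mult_chars \<Longrightarrow> char_mult \<chi> triv_char = \<chi>"
  by (auto simp: char_mult_def triv_char_def mult_charsD(1))

lemma char_mult_inv: "\<chi> \<in> mult_chars \<Longrightarrow> char_mult \<chi> (char_inv \<chi>) = triv_char"
  by (auto simp: char_mult_def char_inv_def triv_char_def mult_charsD)

lemma char_eq_triv_iff: "\<chi> \<in> mult_chars \<Longrightarrow> \<chi> = triv_char \<longleftrightarrow> (\<forall>x. x \<noteq> 0 \<longrightarrow> \<chi> x = 1)"
  by (auto simp: triv_char_def mult_charsD(1) fun_eq_iff)

section \<open>Orthogonality relations\<close>

text \<open>A generator \<open>h\<close> of the units yields the faithful character sending
  \<open>h ^ i\<close> to exp(2 pi i/n) with n = q - 1 (i the exponent, imaginary unit suppressed).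
  Being injective, it detects every unit other than 1.\<close>

lemma mult_chars_separate:
  fixes a :: "'a::{finite,field}"
  assumes "a \<noteq> 0" "a \<noteq> 1"
  shows "\<exists>\<chi>\<in>mult_chars. \<chi> a \<noteq> 1"
proof -
  define n where "n = card (UNIV :: 'a set) - 1"
  obtain h :: 'a where h: "h \<noteq> 0" "h ^ n = 1" and gen: "\<And>x. x \<noteq> 0 \<Longrightarrow> \<exists>i. x = h ^ i"
    unfolding n_def by (rule finite_field_generator) blast
  have n0: "n > 0"
  proof -
    have "card {0, 1 :: 'a} \<le> card (UNIV :: 'a set)" by (rule card_mono) auto
    then show ?thesis by (simp add: n_def)
  qed
  have hmod: "h ^ (i mod n) = h ^ i" for i
  proof -
    have "h ^ i = h ^ (n * (i div n) + i mod n)" by simp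
    also have "\<dots> = h ^ (i mod n)" by (simp only: power_add power_mult h) simp
    finally show ?thesis by simp
  qed
  have surj: "(\<lambda>i. h ^ i) ` {..<n} = UNIV - {0}"
  proof (intro equalityI subsetI)
    fix x :: 'a assume "x \<in> UNIV - {0}"
    with gen obtain i where "x = h ^ i" by auto
    then have "x = h ^ (i mod n)" "i mod n \<in> {..<n}" using n0 by (simp_all add: hmod)
    then show "x \<in> (\<lambda>i. h ^ i) ` {..<n}" by blast
  qed (use h in auto)
  \<comment> \<open>The n exponents below n map onto the n units, so the map is injective by
    counting.\<close>
  have inj: "inj_on (\<lambda>i. h ^ i) {..<n}"
    by (rule eq_card_imp_inj_on) (simp_all only: surj finite_lessThan, simp add: n_def card_Diff_singleton)
  \<comment> \<open>\<open>d\<close> is the discrete logarithm to base \<open>h\<close>, normalised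
    to lie below n.\<close>
  define d where "d = (\<lambda>x. the_inv_into {..<n} (\<lambda>i. h ^ i) x)"
  have dpow: "d (h ^ i) = i mod n" for i
    unfolding d_def using the_inv_into_f_f[OF inj, of "i mod n"] n0 by (simp add: hmod)
  define \<chi> where "\<chi> = (\<lambda>x::'a. if x = 0 then 0 else cis (2 * pi * real (d x) / real n))"
  have cis_mod: "cis (2 * pi * real (i mod n) / real n) = cis (2 * pi * real i / real n)" for i
  proof -
    have "real i = real n * real (i div n) + real (i mod n)"
      by (metis mult_div_mod_eq of_nat_add of_nat_mult)
    then have "2 * pi * real i / real n = 2 * pi * real (i mod n) / real n + 2 * pi * real (i div n)"
      using n0 by (simp add: field_simps)
    then show ?thesis
      by (simp add: cis_mult[symmetric] cis_multiple_2pi)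
  qed
  have \<chi>pow: "\<chi> (h ^ i) = cis (2 * pi * real i / real n)" for i
    using h by (simp add: \<chi>_def dpow cis_mod)
  have "\<chi> (x * y) = \<chi> x * \<chi> y" for x y
  proof (cases "x = 0 \<or> y = 0")
    case True
    then show ?thesis by (auto simp: \<chi>_def)
  next
    case False
    then obtain i j where "x = h ^ i" "y = h ^ j" using gen by metis
    then show ?thesis
      by (simp only: power_add[symmetric] \<chi>pow cis_mult)
         (simp add: ring_class.ring_distribs add_divide_distrib)
  qed
  moreover have "\<chi> 1 = 1" using \<chi>pow[of 0] by simp
  ultimately have mem: "\<chi> \<in> mult_chars"
    by (auto simp: mult_chars_def \<chi>_def)
  obtain i where i: "i < n" "a = h ^ i"
    using surj assms(1) by (metis DiffI UNIV_I imageE lessThan_iff singletonD)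
  have "i \<noteq> 0" using i assms(2) by (metis power_0)
  have "\<chi> a \<noteq> 1"
  proof
    \<comment> \<open>Then i/n would be an integer, although 0 < i < n.\<close>
    assume "\<chi> a = 1"
    then have "cos (2 * pi * real i / real n) = 1"
      by (simp add: i \<chi>pow complex_eq_iff)
    then obtain k :: int where "2 * pi * real i / real n = of_int k * 2 * pi"
      using cos_one_2pi_int by auto
    then have "real i = of_int k * real n"
      using n0 by (simp add: field_simps)
    then have "int i = k * int n"
      by (metis of_int_eq_iff of_int_mult of_int_of_nat_eq)
    then have "n dvd i" by (metis dvd_triv_right int_dvd_int_iff)
    with i \<open>i \<noteq> 0\<close> show False by (auto dest: dvd_imp_le)
  qed
  with mem show ?thesis by blast
qed

lemma bij_betw_char_mult:
  assumes "\<chi> \<in> mult_chars"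
  shows "bij_betw (char_mult \<chi>) mult_chars mult_chars"
proof (rule bij_betw_byWitness[where f' = "char_mult (char_inv \<chi>)"])
  have "char_mult (char_inv \<chi>) (char_mult \<chi> \<nu>) = \<nu> \<and> char_mult \<chi> (char_mult (char_inv \<chi>) \<nu>) = \<nu>"
    if "\<nu> \<in> mult_chars" for \<nu>
    using assms that
    by (metis char_mult_assoc char_mult_commute char_mult_inv char_mult_triv)
  then show "\<forall>\<nu>\<in>mult_chars. char_mult (char_inv \<chi>) (char_mult \<chi> \<nu>) = \<nu>"
    "\<forall>\<nu>\<in>mult_chars. char_mult \<chi> (char_mult (char_inv \<chi>) \<nu>) = \<nu>" by auto
qed (use assms in \<open>auto intro: char_mult_mem char_inv_mem\<close>)

text \<open>Translation by a character that is not 1 at \<open>a\<close> permutes the characters and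
  multiplies the sum by a number other than 1. The factor \<open>card mult_chars\<close> stays
  symbolic, since it later occurs on both sides of the transformation.\<close>

lemma sum_mult_chars:
  fixes a :: "'a::{finite,field}"
  assumes "a \<noteq> 0"
  shows "(\<Sum>\<nu>\<in>mult_chars. \<nu> a) = (if a = 1 then of_nat (card (mult_chars :: ('a \<Rightarrow> complex) set)) else 0)"
proof (cases "a = 1")
  case True
  then show ?thesis by (simp add: mult_charsD(3))
next
  case False
  then obtain \<chi> where \<chi>: "\<chi> \<in> mult_chars" "\<chi> a \<noteq> 1"
    using mult_chars_separate assms by blast
  have "(\<Sum>\<nu>\<in>mult_chars. \<nu> a) = (\<Sum>\<nu>\<in>mult_chars. char_mult \<chi> \<nu> a)"
    using sum.reindex_bij_betw[OF bij_betw_char_mult[OF \<chi>(1)], of "\<lambda>\<nu>. \<nu> a"] by simp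
  also have "\<dots> = \<chi> a * (\<Sum>\<nu>\<in>mult_chars. \<nu> a)"
    by (simp add: char_mult_def sum_distrib_left)
  finally show ?thesis using \<chi>(2) False by simp
qed

text \<open>The change of variables behind most of the later manipulations of sums over
  units.\<close>

lemma sum_units_mult:
  fixes t :: "'a::{finite,field}"
  assumes "t \<noteq> 0"
  shows "(\<Sum>x\<in>UNIV - {0}. f (t * x)) = (\<Sum>x\<in>UNIV - {0}. f x)"
  by (rule sum.reindex_bij_witness[where i = "\<lambda>x. x / t" and j = "\<lambda>x. t * x"]) (use assms in auto)

lemma sum_units_divide:
  fixes t :: "'a::{finite,field}"
  assumes "t \<noteq> 0"
  shows "(\<Sum>x\<in>UNIV - {0}. f (t / x)) = (\<Sum>x\<in>UNIV - {0}. f x)"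
  by (rule sum.reindex_bij_witness[where i = "\<lambda>x. t / x" and j = "\<lambda>x. t / x"]) (use assms in auto)

lemma sum_units_char:
  assumes "\<chi> \<in> mult_chars" "\<chi> \<noteq> triv_char"
  shows "(\<Sum>x\<in>UNIV - {0}. \<chi> x) = 0"
proof -
  obtain t where t: "t \<noteq> 0" "\<chi> t \<noteq> 1"
    using assms char_eq_triv_iff by blast
  have "(\<Sum>x\<in>UNIV - {0}. \<chi> x) = \<chi> t * (\<Sum>x\<in>UNIV - {0}. \<chi> x)"
    using sum_units_mult[OF t(1), of \<chi>] assms(1) by (simp add: mult_charsD(4) sum_distrib_left)
  then show ?thesis using t(2) by simp
qed

lemma sum_UNIV_units:
  fixes f :: "'a::{finite,field} \<Rightarrow> complex"
  shows "(\<Sum>x\<in>UNIV. f x) = f 0 + (\<Sum>x\<in>UNIV - {0}. f x)"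
  by (simp add: sum.remove)

lemma sum_UNIV_char:
  assumes "\<chi> \<in> mult_chars" "\<chi> \<noteq> triv_char"
  shows "(\<Sum>x\<in>UNIV. \<chi> x) = 0"
  using sum_units_char[OF assms] assms(1) by (simp add: sum_UNIV_units mult_charsD(1))

section \<open>The quadratic character and sums over squares\<close>

text \<open>A square factor does not affect whether a product is a square. Nonsquares are odd powers
  of a generator, so the product of two of them is an even power and hence a square.\<close>

lemma quad_char_mem: "(quad_char :: 'a::{finite,field} \<Rightarrow> complex) \<in> mult_chars"
proof -
  obtain h :: 'a where "h \<noteq> 0" "h ^ (card (UNIV :: 'a set) - 1) = 1"
    and gen: "\<And>x. x \<noteq> 0 \<Longrightarrow> \<exists>i. x = h ^ i"
    by (rule finite_field_generator) (rule that)
  have nonsq_odd: "\<exists>k. x = h ^ Suc (2 * k)" if x: "x \<noteq> 0" "\<nexists>z. x = z * z" for x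
  proof -
    obtain i where i: "x = h ^ i" using gen[OF x(1)] by blast
    have "odd i"
    proof
      assume "even i"
      then obtain k where "i = 2 * k" by (rule evenE)
      then have "x = h ^ k * h ^ k" using i by (simp add: power_add mult_2)
      with x(2) show False by blast
    qed
    then obtain k where "i = 2 * k + 1" by (rule oddE)
    with i show ?thesis by auto
  qed
  have "quad_char (x * y) = quad_char x * quad_char y" for x y :: 'a
  proof (cases "x = 0 \<or> y = 0")
    case True
    then show ?thesis by (auto simp: quad_char_def)
  next
    case False
    have sq: "(\<exists>z. x * y = z * z) \<longleftrightarrow> (\<exists>z. y = z * z)" if "x = w * w" "x \<noteq> 0" for x y w :: 'a
    proof
      assume "\<exists>z. x * y = z * z"
      then obtain z where "x * y = z * z" by blast
      then have "y = (z / w) * (z / w)" using that by (auto simp: field_simps)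
      then show "\<exists>z. y = z * z" by blast
    next
      assume "\<exists>z. y = z * z"
      then obtain z where "y = z * z" by blast
      then have "x * y = (w * z) * (w * z)" using that by simp
      then show "\<exists>z. x * y = z * z" by blast
    qed
    show ?thesis
    proof (cases "(\<exists>z. x = z * z) \<or> (\<exists>z. y = z * z)")
      case True
      then show ?thesis
        using sq[of x _ y] sq[of y _ x] False by (auto simp: quad_char_def mult.commute)
    next
      case nonsq: False
      obtain k where "x = h ^ Suc (2 * k)" using nonsq_odd[of x] False nonsq by blast
      moreover obtain l where "y = h ^ Suc (2 * l)" using nonsq_odd[of y] False nonsq by blast
      ultimately have "x * y = h ^ (k + l + 1) * h ^ (k + l + 1)"
        by (simp only: power_add[symmetric]) (simp add: mult_2 add.assoc add.left_commute)
      then show ?thesis using False nonsq by (auto simp: quad_char_def)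
    qed
  qed
  moreover have "quad_char (1::'a) = 1"
    by (auto simp: quad_char_def intro: exI[of _ 1])
  ultimately show ?thesis
    by (simp add: mult_chars_def) (simp add: quad_char_def)
qed

lemma quad_char_square: "x \<noteq> 0 \<Longrightarrow> quad_char x * quad_char x = 1"
  by (simp add: quad_char_def)

text \<open>Since \<open>quad_char\<close> squares to the trivial character, \<beta> and its product
  with \<open>quad_char\<close> have the same square. This makes the Jacobi sum relations applicable
  and lets \<open>gauss0\<close> be replaced by \<open>gauss\<close> for these characters.\<close>

lemma nontriv_if_square_nontriv:
  assumes \<beta>: "\<beta> \<in> mult_chars" "char_mult \<beta> \<beta> \<noteq> triv_char"
  shows "\<beta> \<noteq> triv_char" "char_mult \<beta> quad_char \<noteq> triv_char"
proof -
  show "\<beta> \<noteq> triv_char" using \<beta>(2) char_mult_triv[OF triv_char_mem] by metis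
  show "char_mult \<beta> quad_char \<noteq> triv_char"
  proof
    assume "char_mult \<beta> quad_char = triv_char"
    then have eq: "\<beta> x * quad_char x = triv_char x" for x
      by (metis char_mult_def)
    have "\<beta> x * \<beta> x = triv_char x" for x
    proof (cases "x = 0")
      case False
      then have "(\<beta> x * quad_char x) * (\<beta> x * quad_char x) = 1"
        by (simp add: eq triv_char_def)
      then have "\<beta> x * \<beta> x * (quad_char x * quad_char x) = 1" by (simp only: ac_simps)
      then show ?thesis using False by (simp add: quad_char_square triv_char_def)
    qed (simp add: triv_char_def mult_charsD(1)[OF \<beta>(1)])
    then show False using \<beta>(2) by (auto simp: char_mult_def)
  qed
qed

lemma four_nonzero: "(2::'a::idom) \<noteq> 0 \<Longrightarrow> (4::'a) \<noteq> 0"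
  by (metis mult_2 mult_eq_0_iff numeral_Bit0)

text \<open>Turns the hypothesis on the characteristic into invertibility of 2, the form in which
  completing the square uses it.\<close>

lemma CHAR_neq_2_iff: "CHAR('a::{finite,field}) \<noteq> 2 \<longleftrightarrow> (2::'a) \<noteq> 0"
proof -
  have "prime (CHAR('a))"
    by (rule prime_CHAR_semidom) (rule finite_imp_CHAR_pos, simp)
  moreover have "(2::'a) = 0 \<longleftrightarrow> CHAR('a) dvd 2"
    by (metis of_nat_eq_0_iff_char_dvd of_nat_numeral)
  ultimately show ?thesis
    by (metis dvd_refl two_is_prime_nat primes_dvd_imp_eq)
qed

text \<open>The number of square roots of s is \<open>1 + quad_char s\<close>: two, one or none for
  s a nonzero square, zero or a nonsquare. Odd characteristic keeps z and -z apart.\<close>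

lemma sum_square_quad_char:
  fixes f :: "'a::{finite,field} \<Rightarrow> complex"
  assumes "(2::'a) \<noteq> 0"
  shows "(\<Sum>t\<in>UNIV. f (t * t)) = (\<Sum>s\<in>UNIV. (1 + quad_char s) * f s)"
proof -
  have fib: "of_nat (card {t. t * t = s}) = 1 + quad_char s" for s :: 'a
  proof (cases "\<exists>z. s = z * z")
    case True
    then obtain z where z: "s = z * z" by blast
    have eq: "{t. t * t = s} = {z, - z}"
      by (auto simp: z square_eq_iff)
    show ?thesis
    proof (cases "z = 0")
      case True
      then show ?thesis by (simp add: eq) (simp add: z quad_char_def)
    next
      case False
      have "z \<noteq> - z"
      proof
        assume "z = - z"
        then have "2 * z = 0" by (metis add.right_inverse mult_2)
        then show False using assms False by simp
      qed
      moreover have "quad_char s = 1" using False z by (auto simp: quad_char_def)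
      ultimately show ?thesis by (simp add: eq)
    qed
  next
    case False
    then have "{t. t * t = s} = {}" "s \<noteq> 0" by (auto intro: exI[of _ 0])
    then show ?thesis using False by (simp add: quad_char_def)
  qed
  have "(\<Sum>t\<in>UNIV. f (t * t)) = (\<Sum>s\<in>UNIV. \<Sum>t\<in>{t. t * t = s}. f (t * t))"
    using sum.group[of UNIV UNIV "\<lambda>t. t * t" "\<lambda>t. f (t * t)"] by simp
  also have "\<dots> = (\<Sum>s\<in>UNIV. of_nat (card {t. t * t = s}) * f s)"
    by (intro sum.cong) auto
  finally show ?thesis by (simp add: fib)
qed

section \<open>Additive characters and Gauss sums\<close>

locale nontriv_additive_character =
  fixes \<psi> :: "'a::{finite,field} \<Rightarrow> complex"
  assumes nontriv: "nontriv_add_char \<psi>"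
begin

lemma psi_add: "\<psi> (x + y) = \<psi> x * \<psi> y"
  and psi_0: "\<psi> 0 = 1"
  using nontriv by (auto simp: nontriv_add_char_def add_char_def)

lemma sum_psi: "(\<Sum>x\<in>UNIV. \<psi> x) = 0"
proof -
  obtain t where t: "\<psi> t \<noteq> 1" using nontriv by (auto simp: nontriv_add_char_def)
  have "(\<Sum>x\<in>UNIV. \<psi> x) = (\<Sum>x\<in>UNIV. \<psi> (t + x))"
    by (rule sum.reindex_bij_witness[where i = "\<lambda>x. t + x" and j = "\<lambda>x. x - t"]) auto
  also have "\<dots> = \<psi> t * (\<Sum>x\<in>UNIV. \<psi> x)"
    by (simp add: psi_add sum_distrib_left)
  finally show ?thesis using t by simp
qed

lemma sum_units_psi_scaled:
  "(\<Sum>x\<in>UNIV - {0}. \<psi> (x * t)) = (if t = 0 then of_nat (card (UNIV :: 'a set)) else 0) - 1"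
proof (cases "t = 0")
  case True
  have "card (UNIV :: 'a set) > 0" by (simp add: card_gt_0_iff)
  then show ?thesis using True by (simp add: psi_0 of_nat_diff)
next
  case False
  then show ?thesis
    using sum_psi sum_units_mult[OF False, of \<psi>] sum_UNIV_units[of \<psi>]
    by (simp add: psi_0 mult.commute eq_neg_iff_add_eq_0 add.commute)
qed

lemma gauss_triv: "gauss \<psi> triv_char = 1"
proof -
  have "(\<Sum>x\<in>UNIV - {0}. \<psi> x * triv_char x) = (\<Sum>x\<in>UNIV - {0}. \<psi> (x * 1))"
    by (intro sum.cong) (auto simp: triv_char_def)
  then show ?thesis by (simp add: gauss_def sum_units_psi_scaled del: mult_1_right)
qed

lemma sum_UNIV_gauss: "\<chi> \<in> mult_chars \<Longrightarrow> (\<Sum>x\<in>UNIV. \<psi> x * \<chi> x) = - gauss \<psi> \<chi>"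
  by (simp add: gauss_def sum_UNIV_units mult_charsD(1))

lemma sum_UNIV_gauss_scaled:
  assumes "\<chi> \<in> mult_chars" "t \<noteq> 0"
  shows "(\<Sum>x\<in>UNIV. \<psi> (t * x) * \<chi> x) = - gauss \<psi> \<chi> / \<chi> t"
proof -
  have "(\<Sum>x\<in>UNIV. \<psi> (t * x) * \<chi> x) = (\<Sum>x\<in>UNIV - {0}. \<psi> (t * x) * \<chi> x)"
    using assms by (simp add: sum_UNIV_units mult_charsD(1))
  also have "\<dots> = (\<Sum>x\<in>UNIV - {0}. \<psi> (t * x) * \<chi> (t * x) / \<chi> t)"
    using assms by (simp add: mult_charsD)
  also have "\<dots> = (\<Sum>x\<in>UNIV - {0}. \<psi> x * \<chi> x / \<chi> t)"
    by (rule sum_units_mult[OF assms(2), of "\<lambda>x. \<psi> x * \<chi> x / \<chi> t"])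
  finally show ?thesis by (simp add: gauss_def sum_divide_distrib sum_negf)
qed

text \<open>After x = yt the sum over y is a complete exponential sum without its term at 0. It
  gives q at t = -1, and its constant part -1 disappears because \<chi> is nontrivial.\<close>

lemma gauss_mult_gauss_inv:
  assumes \<chi>: "\<chi> \<in> mult_chars" "\<chi> \<noteq> triv_char"
  shows "gauss \<psi> \<chi> * gauss \<psi> (char_inv \<chi>) = \<chi> (- 1) * of_nat (card (UNIV :: 'a set))"
proof -
  let ?U = "UNIV - {0 :: 'a}" and ?q = "of_nat (card (UNIV :: 'a set)) :: complex"
  have "gauss \<psi> \<chi> * gauss \<psi> (char_inv \<chi>)
      = (\<Sum>y\<in>?U. \<Sum>x\<in>?U. \<psi> (x + y) * (\<chi> x / \<chi> y))"
    unfolding gauss_def minus_mult_minus sum_product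
    by (subst sum.swap) (simp add: psi_add char_inv_eq \<chi> field_class.field_divide_inverse ac_simps)
  also have "\<dots> = (\<Sum>y\<in>?U. \<Sum>t\<in>?U. \<psi> (y * t + y) * (\<chi> (y * t) / \<chi> y))"
    by (rule sum.cong[OF refl], rule sum_units_mult[symmetric]) simp
  also have "\<dots> = (\<Sum>t\<in>?U. \<Sum>y\<in>?U. \<psi> (y * (t + 1)) * \<chi> t)"
    by (subst sum.swap) (intro sum.cong refl, simp add: \<chi> mult_charsD algebra_simps)
  also have "\<dots> = (\<Sum>t\<in>?U. ((if t + 1 = 0 then ?q else 0) - 1) * \<chi> t)"
    by (simp only: sum_distrib_right[symmetric] sum_units_psi_scaled)
  also have "\<dots> = (\<Sum>t\<in>?U. (if t = - 1 then ?q * \<chi> (- 1) else 0)) - (\<Sum>t\<in>?U. \<chi> t)"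
    unfolding sum_subtractf[symmetric]
    by (intro sum.cong refl) (simp add: eq_neg_iff_add_eq_0[of _ 1] left_diff_distrib, metis add.commute add_eq_0_iff)
  also have "\<dots> = \<chi> (- 1) * ?q"
    by (simp add: sum_units_char \<chi>)
  finally show ?thesis .
qed

text \<open>For the trivial character both Gauss sums are 1, and the factor q built into
  \<open>gauss0\<close> supplies exactly what is missing. The reflection formula thus becomes
  uniform in \<chi>.\<close>

lemma gauss0_mult_gauss_inv:
  assumes "\<chi> \<in> mult_chars"
  shows "gauss0 \<psi> \<chi> * gauss \<psi> (char_inv \<chi>) = \<chi> (- 1) * of_nat (card (UNIV :: 'a set))"
proof (cases "\<chi> = triv_char")
  case True
  moreover have "char_inv triv_char = (triv_char :: 'a \<Rightarrow> complex)"
    by (auto simp: char_inv_def triv_char_def)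
  ultimately show ?thesis
    by (simp add: gauss0_def gauss_triv) (simp add: triv_char_def)
qed (use assms in \<open>simp add: gauss0_def gauss_mult_gauss_inv\<close>)

lemma gauss0_nonzero: "\<chi> \<in> mult_chars \<Longrightarrow> gauss0 \<psi> \<chi> \<noteq> 0"
  using gauss0_mult_gauss_inv[of \<chi>] mult_charsD(2)[of \<chi> "- 1"] by auto

lemma gauss_nonzero: "\<chi> \<in> mult_chars \<Longrightarrow> gauss \<psi> \<chi> \<noteq> 0"
  using gauss0_nonzero[of \<chi>] by (auto simp: gauss0_def)

text \<open>Moves the denominators of the hypergeometric sums into the numerator, where they can be
  expanded as Gauss sums. The sign may be moved across because \<chi>(-1) squares to 1.\<close>

lemma inverse_gauss0:
  assumes "\<chi> \<in> mult_chars"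
  shows "1 / gauss0 \<psi> \<chi> = \<chi> (- 1) * gauss \<psi> (char_inv \<chi>) / of_nat (card (UNIV :: 'a set))"
proof -
  have "1 / gauss0 \<psi> \<chi> = \<chi> (- 1) * (\<chi> (- 1) * of_nat (card (UNIV :: 'a set))) / (gauss0 \<psi> \<chi> * of_nat (card (UNIV :: 'a set)))"
    by (simp add: mult.assoc[symmetric] mult_char_minus_one_square[OF assms])
  also have "\<dots> = \<chi> (- 1) * gauss \<psi> (char_inv \<chi>) / of_nat (card (UNIV :: 'a set))"
    by (simp add: gauss0_mult_gauss_inv[OF assms, symmetric] gauss0_nonzero[OF assms])
  finally show ?thesis .
qed

section \<open>Jacobi sums and the Hasse-Davenport relation\<close>

text \<open>No sign is included, in contrast to \<open>gauss\<close>; hence the minus sign in the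
  relation between the two.\<close>

definition jacobi :: "('a \<Rightarrow> complex) \<Rightarrow> ('a \<Rightarrow> complex) \<Rightarrow> complex" where
  "jacobi \<chi> \<eta> = (\<Sum>x\<in>UNIV. \<chi> x * \<eta> (1 - x))"

text \<open>Collecting pairs by s = x + y leaves a convolution of the two characters, which is
  homogeneous in s. Its value at s = 0 vanishes because the product character is nontrivial.\<close>

lemma gauss_mult_gauss:
  assumes \<chi>: "\<chi> \<in> mult_chars" and \<eta>: "\<eta> \<in> mult_chars" and nt: "char_mult \<chi> \<eta> \<noteq> triv_char"
  shows "gauss \<psi> \<chi> * gauss \<psi> \<eta> = - jacobi \<chi> \<eta> * gauss \<psi> (char_mult \<chi> \<eta>)"
proof -
  have inner: "(\<Sum>x\<in>UNIV. \<chi> x * \<eta> (s - x)) = jacobi \<chi> \<eta> * char_mult \<chi> \<eta> s" for s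
  proof (cases "s = 0")
    case True
    have "\<chi> x * \<eta> (- x) = \<eta> (- 1) * char_mult \<chi> \<eta> x" for x
      using mult_charsD(4)[OF \<eta>, of "- 1" x] by (simp add: char_mult_def)
    then have "(\<Sum>x\<in>UNIV. \<chi> x * \<eta> (s - x)) = \<eta> (- 1) * (\<Sum>x\<in>UNIV. char_mult \<chi> \<eta> x)"
      using True by (simp add: sum_distrib_left)
    also have "\<dots> = 0" by (simp add: sum_UNIV_char char_mult_mem \<chi> \<eta> nt)
    finally show ?thesis using True by (simp add: char_mult_def mult_charsD(1)[OF \<chi>])
  next
    case False
    have "(\<Sum>x\<in>UNIV. \<chi> x * \<eta> (s - x)) = (\<Sum>t\<in>UNIV. \<chi> (s * t) * \<eta> (s - s * t))"
      by (rule sum.reindex_bij_witness[where i = "\<lambda>t. s * t" and j = "\<lambda>x. x / s"]) (use False in auto)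
    also have "\<dots> = (\<Sum>t\<in>UNIV. \<chi> t * \<eta> (1 - t) * (\<chi> s * \<eta> s))"
    proof (intro sum.cong refl)
      fix t
      have "\<eta> (s - s * t) = \<eta> s * \<eta> (1 - t)"
        by (simp add: mult_charsD(4)[OF \<eta>, symmetric] algebra_simps)
      then show "\<chi> (s * t) * \<eta> (s - s * t) = \<chi> t * \<eta> (1 - t) * (\<chi> s * \<eta> s)"
        by (simp add: mult_charsD(4)[OF \<chi>])
    qed
    finally show ?thesis by (simp add: jacobi_def char_mult_def sum_distrib_right)
  qed
  have "gauss \<psi> \<chi> * gauss \<psi> \<eta> = (\<Sum>x\<in>UNIV. \<Sum>y\<in>UNIV. \<psi> x * \<chi> x * (\<psi> y * \<eta> y))"
    using sum_UNIV_gauss[OF \<chi>] sum_UNIV_gauss[OF \<eta>] by (simp add: sum_product[symmetric])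
  also have "\<dots> = (\<Sum>x\<in>UNIV. \<Sum>s\<in>UNIV. \<psi> x * \<chi> x * (\<psi> (s - x) * \<eta> (s - x)))"
  proof (rule sum.cong[OF refl])
    fix x
    show "(\<Sum>y\<in>UNIV. \<psi> x * \<chi> x * (\<psi> y * \<eta> y)) = (\<Sum>s\<in>UNIV. \<psi> x * \<chi> x * (\<psi> (s - x) * \<eta> (s - x)))"
      by (rule sum.reindex_bij_witness[where i = "\<lambda>s. s - x" and j = "\<lambda>y. y + x"]) simp_all
  qed
  also have "\<dots> = (\<Sum>s\<in>UNIV. \<Sum>x\<in>UNIV. \<psi> s * (\<chi> x * \<eta> (s - x)))"
  proof (subst sum.swap, intro sum.cong refl)
    fix s x
    have "\<psi> s = \<psi> x * \<psi> (s - x)" using psi_add[of x "s - x"] by simp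
    then show "\<psi> x * \<chi> x * (\<psi> (s - x) * \<eta> (s - x)) = \<psi> s * (\<chi> x * \<eta> (s - x))" by simp
  qed
  also have "\<dots> = jacobi \<chi> \<eta> * (\<Sum>s\<in>UNIV. \<psi> s * char_mult \<chi> \<eta> s)"
    by (simp only: sum_distrib_left[symmetric] inner) (simp add: sum_distrib_left mult.left_commute)
  finally show ?thesis
    by (simp add: sum_UNIV_gauss char_mult_mem \<chi> \<eta>)
qed

text \<open>The substitution x = (1 - t)/2 turns 4x(1 - x) into 1 - t^2. Counting square roots then
  produces the Jacobi sum with \<open>quad_char\<close> plus a complete sum of \<beta>, which is
  0.\<close>

lemma jacobi_duplication:
  assumes two: "(2::'a) \<noteq> 0" and \<beta>: "\<beta> \<in> mult_chars" "\<beta> \<noteq> triv_char"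
  shows "\<beta> 4 * jacobi \<beta> \<beta> = jacobi \<beta> quad_char"
proof -
  have half: "(1 - t) / 2 * 4 * (1 - (1 - t) / 2) = 1 - t * t" for t :: 'a
  proof -
    \<comment> \<open>With 2h = 1 - t as an assumption the claim becomes a polynomial identity, free
      of division.\<close>
    have "h * 4 * (1 - h) = 1 - t * t" if "2 * h = 1 - t" for h
    proof -
      have t: "t = 1 - 2 * h" using that by (simp add: algebra_simps)
      show ?thesis unfolding t by (simp add: algebra_simps)
    qed
    moreover have "2 * ((1 - t) / 2) = 1 - t" using two by simp
    ultimately show ?thesis by blast
  qed
  have "\<beta> 4 * jacobi \<beta> \<beta> = (\<Sum>x\<in>UNIV. \<beta> (x * 4 * (1 - x)))"
    unfolding jacobi_def sum_distrib_left mult_charsD(4)[OF \<beta>(1)] by (simp only: ac_simps)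
  also have "\<dots> = (\<Sum>t\<in>UNIV. \<beta> ((1 - t) / 2 * 4 * (1 - (1 - t) / 2)))"
    by (rule sum.reindex_bij_witness[where i = "\<lambda>t. (1 - t) / 2" and j = "\<lambda>x. 1 - 2 * x"])
       (use two in \<open>auto simp: diff_divide_distrib\<close>)
  also have "\<dots> = (\<Sum>t\<in>UNIV. \<beta> (1 - t * t))"
    by (simp only: half)
  also have "\<dots> = (\<Sum>s\<in>UNIV. (1 + quad_char s) * \<beta> (1 - s))"
    by (rule sum_square_quad_char[OF two, of "\<lambda>s. \<beta> (1 - s)"])
  also have "\<dots> = (\<Sum>s\<in>UNIV. (1 + quad_char (1 - s)) * \<beta> s)"
    by (rule sum.reindex_bij_witness[where i = "\<lambda>s. 1 - s" and j = "\<lambda>s. 1 - s"]) auto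
  also have "\<dots> = (\<Sum>s\<in>UNIV. \<beta> s) + jacobi \<beta> quad_char"
    by (simp add: jacobi_def sum.distrib algebra_simps)
  finally show ?thesis by (simp add: sum_UNIV_char \<beta>)
qed

text \<open>Multiplying by g(\<beta>) creates g(\<beta>)^2, a multiple of the Jacobi sum of \<beta>
  with itself. Duplication converts that sum into the one of \<beta> with \<open>quad_char\<close>,
  which the same relation turns back into Gauss sums; finally the nonzero g(\<beta>) is
  cancelled.\<close>

lemma hasse_davenport_2:
  assumes two: "(2::'a) \<noteq> 0" and \<beta>: "\<beta> \<in> mult_chars" "char_mult \<beta> \<beta> \<noteq> triv_char"
  shows "\<beta> 4 * gauss \<psi> \<beta> * gauss \<psi> (char_mult \<beta> quad_char) = gauss \<psi> (char_mult \<beta> \<beta>) * gauss \<psi> quad_char"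
proof -
  note nt = nontriv_if_square_nontriv[OF \<beta>]
  have "gauss \<psi> \<beta> * (\<beta> 4 * gauss \<psi> \<beta> * gauss \<psi> (char_mult \<beta> quad_char))
      = \<beta> 4 * (gauss \<psi> \<beta> * gauss \<psi> \<beta>) * gauss \<psi> (char_mult \<beta> quad_char)"
    by simp
  also have "\<dots> = - (\<beta> 4 * jacobi \<beta> \<beta>) * gauss \<psi> (char_mult \<beta> quad_char) * gauss \<psi> (char_mult \<beta> \<beta>)"
    by (subst gauss_mult_gauss) (use \<beta> in simp_all)
  also have "\<dots> = (- jacobi \<beta> quad_char * gauss \<psi> (char_mult \<beta> quad_char)) * gauss \<psi> (char_mult \<beta> \<beta>)"
    by (simp add: jacobi_duplication[OF two \<beta>(1) nt(1)])
  also have "\<dots> = gauss \<psi> \<beta> * gauss \<psi> quad_char * gauss \<psi> (char_mult \<beta> \<beta>)"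
    by (subst gauss_mult_gauss[symmetric]) (use \<beta> nt in \<open>simp_all add: quad_char_mem\<close>)
  finally show ?thesis
    using gauss_nonzero[OF \<beta>(1)] by (simp add: ac_simps)
qed

section \<open>Quadratic exponential sums\<close>

text \<open>Shifting t by b/(2a) completes the square. In the remaining sum over squares the part
  without \<open>quad_char\<close> is a complete exponential sum and vanishes; the other part is a
  scaled Gauss sum.\<close>

lemma sum_psi_quadratic:
  assumes two: "(2::'a) \<noteq> 0" and a: "a \<noteq> 0"
  shows "(\<Sum>t\<in>UNIV. \<psi> (a * (t * t) + b * t)) = - gauss \<psi> quad_char * quad_char a * \<psi> (- (b * b / (4 * a)))"
proof -
  have four: "(4::'a) \<noteq> 0"
    by (rule four_nonzero[OF two])
  have "(\<Sum>t\<in>UNIV. \<psi> (a * (t * t) + b * t))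
      = (\<Sum>t\<in>UNIV. \<psi> (a * ((t - b / (2 * a)) * (t - b / (2 * a))) + b * (t - b / (2 * a))))"
    by (rule sum.reindex_bij_witness[where i = "\<lambda>t. t - b / (2 * a)" and j = "\<lambda>t. t + b / (2 * a)"]) auto
  also have "\<dots> = (\<Sum>t\<in>UNIV. \<psi> (a * (t * t)) * \<psi> (- (b * b / (4 * a))))"
  proof (intro sum.cong refl)
    fix t
    have "a * ((t - e) * (t - e)) + b * (t - e) = a * (t * t) + - d"
      if "2 * a * e = b" "a * e * e = d" for d e
      by (simp add: that[symmetric] algebra_simps)
    moreover have "2 * a * (b / (2 * a)) = b" "a * (b / (2 * a)) * (b / (2 * a)) = b * b / (4 * a)"
      using two four a by (simp_all add: field_simps)
    ultimately have "a * ((t - b / (2 * a)) * (t - b / (2 * a))) + b * (t - b / (2 * a)) = a * (t * t) + - (b * b / (4 * a))"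
      by blast
    then show "\<psi> (a * ((t - b / (2 * a)) * (t - b / (2 * a))) + b * (t - b / (2 * a)))
        = \<psi> (a * (t * t)) * \<psi> (- (b * b / (4 * a)))"
      by (simp only: psi_add)
  qed
  also have "\<dots> = (\<Sum>t\<in>UNIV. \<psi> (a * (t * t))) * \<psi> (- (b * b / (4 * a)))"
    by (simp only: sum_distrib_right)
  also have "(\<Sum>t\<in>UNIV. \<psi> (a * (t * t))) = (\<Sum>s\<in>UNIV. \<psi> (a * s)) + (\<Sum>s\<in>UNIV. \<psi> (a * s) * quad_char s)"
    by (subst sum_square_quad_char[OF two, of "\<lambda>s. \<psi> (a * s)"])
       (simp add: sum.distrib distrib_right mult.commute)
  also have "(\<Sum>s\<in>UNIV. \<psi> (a * s)) = 0"
    using sum_units_psi_scaled[of a] a by (simp add: sum_UNIV_units psi_0 mult.commute)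
  also have "(\<Sum>s\<in>UNIV. \<psi> (a * s) * quad_char s) = - gauss \<psi> quad_char * quad_char a"
  proof -
    have "1 / quad_char a = quad_char a" using quad_char_square[OF a] by (metis nonzero_divide_eq_eq mult_zero_left zero_neq_one)
    then show ?thesis
      by (simp only: sum_UNIV_gauss_scaled[OF quad_char_mem a])
         (metis times_divide_eq_right mult.right_neutral)
  qed
  finally show ?thesis by simp
qed

section \<open>Sums over characters of products of four Gauss sums\<close>

text \<open>What remains of four Gauss sum variables once orthogonality has forced x4 = x1 x2 z /
  x3.\<close>

definition gauss_kernel :: "('a \<Rightarrow> complex) \<Rightarrow> ('a \<Rightarrow> complex) \<Rightarrow> ('a \<Rightarrow> complex) \<Rightarrow> 'a \<Rightarrow> complex" where
  "gauss_kernel A B C z = (\<Sum>x1\<in>UNIV - {0}. \<Sum>x2\<in>UNIV - {0}. \<Sum>x3\<in>UNIV - {0}.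
     A x1 * B x2 * C x3 * \<psi> (x1 + x2 + x3 + x1 * x2 * z / x3))"

text \<open>The four minus signs of the Gauss sums cancel, and all occurrences of \<nu> combine into
  one value at x1 x2 z / (x3 x4), which is nonzero. Orthogonality selects the terms where it equals
  1.\<close>

lemma sum_mult_chars_gauss:
  assumes z: "z \<noteq> 0"
  shows "(\<Sum>\<nu>\<in>mult_chars. gauss \<psi> (char_mult A \<nu>) * gauss \<psi> (char_mult B \<nu>)
      * gauss \<psi> (char_mult C (char_inv \<nu>)) * gauss \<psi> (char_inv \<nu>) * \<nu> z)
    = of_nat (card (mult_chars :: ('a \<Rightarrow> complex) set)) * gauss_kernel A B C z"
proof -
  let ?U = "UNIV - {0 :: 'a}" and ?N = "of_nat (card (mult_chars :: ('a \<Rightarrow> complex) set)) :: complex"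
  let ?P = "\<lambda>x1 x2 x3. A x1 * B x2 * C x3 * \<psi> (x1 + x2 + x3)"
  have prod: "sum f1 ?U * sum f2 ?U * sum f3 ?U * sum f4 ?U * c
      = (\<Sum>x1\<in>?U. \<Sum>x2\<in>?U. \<Sum>x3\<in>?U. \<Sum>x4\<in>?U. f1 x1 * f2 x2 * f3 x3 * f4 x4 * c)"
    for f1 f2 f3 f4 :: "'a \<Rightarrow> complex" and c
    by (simp only: sum_distrib_left[symmetric] sum_distrib_right[symmetric])
  have pointwise: "gauss \<psi> (char_mult A \<nu>) * gauss \<psi> (char_mult B \<nu>)
      * gauss \<psi> (char_mult C (char_inv \<nu>)) * gauss \<psi> (char_inv \<nu>) * \<nu> z
    = (\<Sum>x1\<in>?U. \<Sum>x2\<in>?U. \<Sum>x3\<in>?U. \<Sum>x4\<in>?U. ?P x1 x2 x3 * \<psi> x4 * \<nu> (x1 * x2 * z / (x3 * x4)))"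
    if \<nu>: "\<nu> \<in> mult_chars" for \<nu>
  proof -
    have "gauss \<psi> (char_mult A \<nu>) * gauss \<psi> (char_mult B \<nu>)
      * gauss \<psi> (char_mult C (char_inv \<nu>)) * gauss \<psi> (char_inv \<nu>) * \<nu> z
      = (\<Sum>x1\<in>?U. \<Sum>x2\<in>?U. \<Sum>x3\<in>?U. \<Sum>x4\<in>?U.
          \<psi> x1 * char_mult A \<nu> x1 * (\<psi> x2 * char_mult B \<nu> x2)
          * (\<psi> x3 * char_mult C (char_inv \<nu>) x3) * (\<psi> x4 * char_inv \<nu> x4) * \<nu> z)"
      unfolding prod[symmetric] by (simp add: gauss_def)
    also have "\<dots> = (\<Sum>x1\<in>?U. \<Sum>x2\<in>?U. \<Sum>x3\<in>?U. \<Sum>x4\<in>?U.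
        ?P x1 x2 x3 * \<psi> x4 * \<nu> (x1 * x2 * z / (x3 * x4)))"
      by (intro sum.cong refl)
         (simp add: char_mult_def char_inv_eq[OF \<nu>] mult_char_inverse[OF \<nu>] mult_charsD(4)[OF \<nu>] psi_add
           field_class.field_divide_inverse ac_simps)
    finally show ?thesis .
  qed
  have "(\<Sum>\<nu>\<in>mult_chars. gauss \<psi> (char_mult A \<nu>) * gauss \<psi> (char_mult B \<nu>)
      * gauss \<psi> (char_mult C (char_inv \<nu>)) * gauss \<psi> (char_inv \<nu>) * \<nu> z)
    = (\<Sum>\<nu>\<in>mult_chars. \<Sum>x1\<in>?U. \<Sum>x2\<in>?U. \<Sum>x3\<in>?U. \<Sum>x4\<in>?U.
        ?P x1 x2 x3 * \<psi> x4 * \<nu> (x1 * x2 * z / (x3 * x4)))"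
    by (rule sum.cong[OF refl]) (rule pointwise)
  also have "\<dots> = (\<Sum>x1\<in>?U. \<Sum>x2\<in>?U. \<Sum>x3\<in>?U. \<Sum>x4\<in>?U. \<Sum>\<nu>\<in>mult_chars.
        ?P x1 x2 x3 * \<psi> x4 * \<nu> (x1 * x2 * z / (x3 * x4)))"
    by (simp only: sum.swap[of _ _ mult_chars])
  also have "\<dots> = (\<Sum>x1\<in>?U. \<Sum>x2\<in>?U. \<Sum>x3\<in>?U. \<Sum>x4\<in>?U.
        if x4 = x1 * x2 * z / x3 then ?P x1 x2 x3 * \<psi> (x1 * x2 * z / x3) * ?N else 0)"
  proof (intro sum.cong refl)
    fix x1 x2 x3 x4 assume x: "x1 \<in> ?U" "x2 \<in> ?U" "x3 \<in> ?U" "x4 \<in> ?U"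
    then have nz: "x1 * x2 * z / (x3 * x4) \<noteq> 0"
      and eq: "x1 * x2 * z / (x3 * x4) = 1 \<longleftrightarrow> x4 = x1 * x2 * z / x3"
      using z by (auto simp: field_simps)
    show "(\<Sum>\<nu>\<in>mult_chars. ?P x1 x2 x3 * \<psi> x4 * \<nu> (x1 * x2 * z / (x3 * x4)))
      = (if x4 = x1 * x2 * z / x3 then ?P x1 x2 x3 * \<psi> (x1 * x2 * z / x3) * ?N else 0)"
      by (simp only: sum_distrib_left[symmetric] sum_mult_chars[OF nz] eq) simp
  qed
  also have "\<dots> = (\<Sum>x1\<in>?U. \<Sum>x2\<in>?U. \<Sum>x3\<in>?U. ?P x1 x2 x3 * \<psi> (x1 * x2 * z / x3) * ?N)"
    using z by (intro sum.cong refl) simp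
  also have "\<dots> = ?N * gauss_kernel A B C z"
    unfolding gauss_kernel_def sum_distrib_left
    by (intro sum.cong refl) (simp add: psi_add)
  finally show ?thesis .
qed

text \<open>Inverting both denominators by reflection produces \<nu>(-1) twice, so that only the
  sign C(-1) survives.\<close>

lemma sum_mult_chars_gauss0:
  assumes C: "C \<in> mult_chars" and z: "z \<noteq> 0"
  shows "(\<Sum>\<nu>\<in>mult_chars. gauss \<psi> (char_mult A \<nu>) * gauss \<psi> (char_mult B \<nu>)
      / (gauss0 \<psi> (char_mult C \<nu>) * gauss0 \<psi> \<nu>) * \<nu> z)
    = of_nat (card (mult_chars :: ('a \<Rightarrow> complex) set)) / of_nat (card (UNIV :: 'a set))^2
      * C (- 1) * gauss_kernel A B (char_inv C) z"
proof -
  let ?q = "of_nat (card (UNIV :: 'a set)) :: complex"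
  have "gauss \<psi> (char_mult A \<nu>) * gauss \<psi> (char_mult B \<nu>)
      / (gauss0 \<psi> (char_mult C \<nu>) * gauss0 \<psi> \<nu>) * \<nu> z
    = C (- 1) / ?q^2 * (gauss \<psi> (char_mult A \<nu>) * gauss \<psi> (char_mult B \<nu>)
      * gauss \<psi> (char_mult (char_inv C) (char_inv \<nu>)) * gauss \<psi> (char_inv \<nu>) * \<nu> z)"
    if \<nu>: "\<nu> \<in> mult_chars" for \<nu>
  proof -
    have inv: "char_inv (char_mult C \<nu>) = char_mult (char_inv C) (char_inv \<nu>)"
      by (auto simp: char_inv_def char_mult_def)
    have "1 / (gauss0 \<psi> (char_mult C \<nu>) * gauss0 \<psi> \<nu>)
        = (1 / gauss0 \<psi> (char_mult C \<nu>)) * (1 / gauss0 \<psi> \<nu>)"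
      by simp
    also have "\<dots> = (C (- 1) * \<nu> (- 1) * gauss \<psi> (char_mult (char_inv C) (char_inv \<nu>)) / ?q)
        * (\<nu> (- 1) * gauss \<psi> (char_inv \<nu>) / ?q)"
      by (simp only: inverse_gauss0 char_mult_mem C \<nu> inv) (simp add: char_mult_def)
    also have "\<dots> = (\<nu> (- 1) * \<nu> (- 1)) * (C (- 1) / ?q^2 * (gauss \<psi> (char_mult (char_inv C) (char_inv \<nu>)) * gauss \<psi> (char_inv \<nu>)))"
      by (simp add: power2_eq_square)
    finally have inv0: "1 / (gauss0 \<psi> (char_mult C \<nu>) * gauss0 \<psi> \<nu>)
        = C (- 1) / ?q^2 * (gauss \<psi> (char_mult (char_inv C) (char_inv \<nu>)) * gauss \<psi> (char_inv \<nu>))"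
      by (simp add: mult_char_minus_one_square[OF \<nu>])
    have "gauss \<psi> (char_mult A \<nu>) * gauss \<psi> (char_mult B \<nu>)
        / (gauss0 \<psi> (char_mult C \<nu>) * gauss0 \<psi> \<nu>) * \<nu> z
      = gauss \<psi> (char_mult A \<nu>) * gauss \<psi> (char_mult B \<nu>) * \<nu> z
        * (1 / (gauss0 \<psi> (char_mult C \<nu>) * gauss0 \<psi> \<nu>))"
      by simp
    then show ?thesis unfolding inv0 by (simp only: ac_simps)
  qed
  then show ?thesis
    using sum_mult_chars_gauss[OF z, of A B "char_inv C"]
    by (simp add: sum_distrib_left[symmetric] sum_divide_distrib[symmetric])
qed

section \<open>Reduction of both triple sums to a common double sum\<close>

definition bilinear_sum :: "('a \<Rightarrow> complex) \<Rightarrow> ('a \<Rightarrow> complex) \<Rightarrow> 'a \<Rightarrow> complex" where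
  "bilinear_sum A C z = (\<Sum>x\<in>UNIV - {0}. \<Sum>v\<in>UNIV - {0}. A x * C v * \<psi> ((x + v) * (1 + x * z / v)))"

text \<open>The hypothesis excludes m = n = 0, where the left side has the constant value \<open>q - 1\<close> but the right side is -1.\<close>

lemma kloosterman_product:
  assumes "m \<noteq> 0 \<or> n \<noteq> 0"
  shows "(\<Sum>r\<in>UNIV - {0}. \<psi> (m / r + r * n)) = (\<Sum>t\<in>UNIV - {0}. \<psi> (t + m * n / t))"
proof (cases "n = 0")
  case True
  then show ?thesis
    using assms sum_units_divide[of m \<psi>] by simp
next
  case False
  have "(\<Sum>t\<in>UNIV - {0}. \<psi> (t + m * n / t)) = (\<Sum>r\<in>UNIV - {0}. \<psi> (n * r + m * n / (n * r)))"
    by (rule sum_units_mult[OF False, symmetric])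
  also have "\<dots> = (\<Sum>r\<in>UNIV - {0}. \<psi> (m / r + r * n))"
    using False by (intro sum.cong refl) (simp add: ac_simps)
  finally show ?thesis by simp
qed

text \<open>As the second character is the product of the other two, the variable r = x2 can be
  absorbed into x1 and x3. It then occurs only in a Kloosterman sum with parameters x + v and 1 +
  xz/v. Once that sum depends on their product alone, scaling x and v by t splits off the Gauss
  sum.\<close>

lemma gauss_kernel_char_mult:
  assumes A: "A \<in> mult_chars" and C: "C \<in> mult_chars" and z: "z \<noteq> 1"
  shows "gauss_kernel A (char_mult A C) C z = - gauss \<psi> (char_mult A C) * bilinear_sum A C z"
proof -
  let ?U = "UNIV - {0 :: 'a}"
  \<comment> \<open>The unreduced fractions exhibit the summand as a function of r x and r v, ready
    for the two substitutions that follow.\<close>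
  have "gauss_kernel A (char_mult A C) C z = (\<Sum>r\<in>?U. \<Sum>x\<in>?U. \<Sum>v\<in>?U.
      A (r * x) * C (r * v) * \<psi> (r * x / r + r * v / r + r + r * (r * x) * z / (r * v)))"
    unfolding gauss_kernel_def
    by (subst sum.swap, intro sum.cong refl)
       (simp add: char_mult_def mult_charsD(4)[OF A] mult_charsD(4)[OF C] ac_simps)
  also have "\<dots> = (\<Sum>r\<in>?U. \<Sum>x\<in>?U. \<Sum>v\<in>?U. A (r * x) * C v * \<psi> (r * x / r + v / r + r + r * (r * x) * z / v))"
    by (rule sum.cong[OF refl], rule sum.cong[OF refl],
        rule_tac f = "\<lambda>v. A (r * x) * C v * \<psi> (r * x / r + v / r + r + r * (r * x) * z / v)" for r x in sum_units_mult) simp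
  also have "\<dots> = (\<Sum>r\<in>?U. \<Sum>x\<in>?U. \<Sum>v\<in>?U. A x * C v * \<psi> (x / r + v / r + r + r * x * z / v))"
    by (rule sum.cong[OF refl],
        rule_tac f = "\<lambda>x. \<Sum>v\<in>?U. A x * C v * \<psi> (x / r + v / r + r + r * x * z / v)" for r in sum_units_mult) simp
  also have "\<dots> = (\<Sum>x\<in>?U. \<Sum>v\<in>?U. \<Sum>r\<in>?U. A x * C v * \<psi> (x / r + v / r + r + r * x * z / v))"
    by (rule trans[OF sum.swap], rule sum.cong[OF refl], rule sum.swap)
  also have "\<dots> = (\<Sum>x\<in>?U. \<Sum>v\<in>?U. \<Sum>t\<in>?U. A x * C v * \<psi> (t + (x + v) * (1 + x * z / v) / t))"
  proof (rule sum.cong[OF refl], rule sum.cong[OF refl])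
    fix x v assume x: "x \<in> ?U" and v: "v \<in> ?U"
    \<comment> \<open>Both parameters vanish only for x = -v and z = 1; this is where z \<noteq> 1
      is used.\<close>
    have "x + v \<noteq> 0 \<or> 1 + x * z / v \<noteq> 0"
    proof (rule ccontr)
      assume "\<not> ?thesis"
      then have "x = - v" "1 + x * z / v = 0" by (auto simp: eq_neg_iff_add_eq_0)
      then show False using v z by simp
    qed
    then have "(\<Sum>r\<in>?U. \<psi> (x / r + v / r + r + r * x * z / v)) = (\<Sum>t\<in>?U. \<psi> (t + (x + v) * (1 + x * z / v) / t))"
      using kloosterman_product[of "x + v" "1 + x * z / v"]
      by (simp add: add_divide_distrib algebra_simps)
    then show "(\<Sum>r\<in>?U. A x * C v * \<psi> (x / r + v / r + r + r * x * z / v))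
      = (\<Sum>t\<in>?U. A x * C v * \<psi> (t + (x + v) * (1 + x * z / v) / t))"
      by (simp only: sum_distrib_left[symmetric])
  qed
  also have "\<dots> = (\<Sum>t\<in>?U. \<Sum>x\<in>?U. \<Sum>v\<in>?U. A x * C v * \<psi> (t + (x + v) * (1 + x * z / v) / t))"
    by (rule sym, rule trans[OF sum.swap], rule sum.cong[OF refl], rule sum.swap)
  \<comment> \<open>The product of the parameters is homogeneous of degree 1 in (x, v), so scaling
    both variables by t removes the division by t.\<close>
  also have "\<dots> = (\<Sum>t\<in>?U. \<Sum>x\<in>?U. \<Sum>v\<in>?U. A (t * x) * C v * \<psi> (t + (t * x + v) * (1 + t * x * z / v) / t))"
    by (rule sum.cong[OF refl], rule sum_units_mult[symmetric]) simp
  also have "\<dots> = (\<Sum>t\<in>?U. \<Sum>x\<in>?U. \<Sum>v\<in>?U. A (t * x) * C (t * v) * \<psi> (t + (t * x + t * v) * (1 + t * x * z / (t * v)) / t))"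
    by (rule sum.cong[OF refl], rule sum.cong[OF refl], rule sum_units_mult[symmetric]) simp
  also have "\<dots> = (\<Sum>t\<in>?U. \<Sum>x\<in>?U. \<Sum>v\<in>?U. \<psi> t * char_mult A C t * (A x * C v * \<psi> ((x + v) * (1 + x * z / v))))"
  proof (rule sum.cong[OF refl], rule sum.cong[OF refl], rule sum.cong[OF refl])
    fix t x v assume "t \<in> ?U" "x \<in> ?U" "v \<in> ?U"
    then have "(t * x + t * v) * (1 + t * x * z / (t * v)) / t = (x + v) * (1 + x * z / v)"
      by (simp add: field_simps)
    then show "A (t * x) * C (t * v) * \<psi> (t + (t * x + t * v) * (1 + t * x * z / (t * v)) / t)
      = \<psi> t * char_mult A C t * (A x * C v * \<psi> ((x + v) * (1 + x * z / v)))"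
      by (simp add: char_mult_def mult_charsD(4)[OF A] mult_charsD(4)[OF C] psi_add)
  qed
  also have "\<dots> = - gauss \<psi> (char_mult A C) * bilinear_sum A C z"
    by (simp only: sum_distrib_left[symmetric] sum_distrib_right[symmetric] gauss_def bilinear_sum_def minus_minus)
  finally show ?thesis .
qed

text \<open>Scaling x1 by (1 + y)^2 clears the denominator of the argument. With x2 = x3 t and then
  x3 = t \<rho>, the characters in the two inner variables collapse to the inverse of \<beta> at
  \<rho>, and the exponent becomes quadratic in t. Its Gauss sum contributes
  \<open>quad_char\<close> of \<rho>.\<close>

lemma gauss_kernel_square:
  assumes two: "(2::'a) \<noteq> 0" and A: "A \<in> mult_chars" and \<beta>: "\<beta> \<in> mult_chars" "\<beta> \<noteq> triv_char"
    and y: "1 + y \<noteq> 0"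
  shows "gauss_kernel A \<beta> (char_inv (char_mult \<beta> \<beta>)) (4 * y / (1 + y)^2)
    = - A ((1 + y)^2) * char_mult (char_inv \<beta>) quad_char (- 4) * gauss \<psi> quad_char
      * bilinear_sum A (char_mult (char_inv \<beta>) quad_char) (y^2)"
proof -
  let ?U = "UNIV - {0 :: 'a}" and ?u = "(1 + y)^2"
  define C where "C = char_mult (char_inv \<beta>) quad_char"
  have C: "C \<in> mult_chars" unfolding C_def by (intro char_mult_mem char_inv_mem \<beta> quad_char_mem)
  have inv\<beta>: "char_inv \<beta> \<in> mult_chars" by (rule char_inv_mem[OF \<beta>(1)])
  have four: "(4::'a) \<noteq> 0"
    by (rule four_nonzero[OF two])
  have u: "?u \<noteq> 0" using y by simp
  have inner: "(\<Sum>x2\<in>?U. \<Sum>x3\<in>?U. \<beta> x2 * char_inv (char_mult \<beta> \<beta>) x3 * \<psi> (?u * x + x2 + x3 + 4 * x * y * x2 / x3))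
    = - C (- 4) * gauss \<psi> quad_char * (\<Sum>v\<in>?U. C v * \<psi> ((x + v) * (1 + x * y^2 / v)))" for x
  proof -
    define w where "w = x * y"
    have "(\<Sum>x2\<in>?U. \<Sum>x3\<in>?U. \<beta> x2 * char_inv (char_mult \<beta> \<beta>) x3 * \<psi> (?u * x + x2 + x3 + 4 * x * y * x2 / x3))
      = (\<Sum>x3\<in>?U. \<Sum>t\<in>?U. \<beta> (x3 * t) * char_inv (char_mult \<beta> \<beta>) x3 * \<psi> (?u * x + x3 * t + x3 + 4 * x * y * (x3 * t) / x3))"
      by (subst sum.swap, rule sum.cong[OF refl], rule sum_units_mult[symmetric]) simp
    also have "\<dots> = (\<Sum>x3\<in>?U. \<Sum>t\<in>?U. \<beta> t * char_inv \<beta> x3 * \<psi> (?u * x + x3 * t + x3 + 4 * w * t))"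
    proof (rule sum.cong[OF refl], rule sum.cong[OF refl])
      fix x3 t assume "x3 \<in> ?U"
      then have "\<beta> (x3 * t) * char_inv (char_mult \<beta> \<beta>) x3 = \<beta> t * char_inv \<beta> x3"
        and "4 * x * y * (x3 * t) / x3 = 4 * w * t"
        by (simp_all add: char_inv_def char_mult_def mult_charsD(2,4)[OF \<beta>(1)] w_def)
      then show "\<beta> (x3 * t) * char_inv (char_mult \<beta> \<beta>) x3 * \<psi> (?u * x + x3 * t + x3 + 4 * x * y * (x3 * t) / x3)
        = \<beta> t * char_inv \<beta> x3 * \<psi> (?u * x + x3 * t + x3 + 4 * w * t)"
        by (simp only:)
    qed
    also have "\<dots> = (\<Sum>t\<in>?U. \<Sum>\<rho>\<in>?U. \<beta> t * char_inv \<beta> (t * \<rho>) * \<psi> (?u * x + t * \<rho> * t + t * \<rho> + 4 * w * t))"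
      by (subst sum.swap, rule sum.cong[OF refl], rule sum_units_mult[symmetric]) simp
    also have "\<dots> = (\<Sum>t\<in>?U. \<Sum>\<rho>\<in>?U. char_inv \<beta> \<rho> * \<psi> (?u * x) * \<psi> (\<rho> * (t * t) + (\<rho> + 4 * w) * t))"
    proof (rule sum.cong[OF refl], rule sum.cong[OF refl])
      fix t \<rho> assume "t \<in> ?U"
      then have "\<beta> t * char_inv \<beta> (t * \<rho>) = char_inv \<beta> \<rho>"
        by (simp add: char_inv_eq \<beta> mult_charsD(2,4)[OF \<beta>(1)])
      moreover have "?u * x + t * \<rho> * t + t * \<rho> + 4 * w * t = ?u * x + (\<rho> * (t * t) + (\<rho> + 4 * w) * t)"
        by (simp add: algebra_simps)
      ultimately show "\<beta> t * char_inv \<beta> (t * \<rho>) * \<psi> (?u * x + t * \<rho> * t + t * \<rho> + 4 * w * t)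
        = char_inv \<beta> \<rho> * \<psi> (?u * x) * \<psi> (\<rho> * (t * t) + (\<rho> + 4 * w) * t)"
        by (simp only: psi_add mult.assoc)
    qed
    \<comment> \<open>The term t = 0 vanishes because \<open>\<beta>\<close> is nontrivial; adding it completes the quadratic Gauss sum in t.\<close>
    also have "\<dots> = (\<Sum>t\<in>UNIV. \<Sum>\<rho>\<in>?U. char_inv \<beta> \<rho> * \<psi> (?u * x) * \<psi> (\<rho> * (t * t) + (\<rho> + 4 * w) * t))"
    proof -
      have "char_inv \<beta> \<noteq> triv_char"
      proof
        assume "char_inv \<beta> = triv_char"
        then show False using char_mult_inv[OF \<beta>(1)] char_mult_triv[OF \<beta>(1)] \<beta>(2) by simp
      qed
      then have "(\<Sum>\<rho>\<in>?U. char_inv \<beta> \<rho>) = 0" by (rule sum_units_char[OF inv\<beta>])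
      then show ?thesis by (simp add: sum_UNIV_units psi_0 sum_distrib_right[symmetric])
    qed
    also have "\<dots> = (\<Sum>\<rho>\<in>?U. char_inv \<beta> \<rho> * \<psi> (?u * x) * (\<Sum>t\<in>UNIV. \<psi> (\<rho> * (t * t) + (\<rho> + 4 * w) * t)))"
      by (subst sum.swap) (simp add: sum_distrib_left)
    also have "\<dots> = (\<Sum>\<rho>\<in>?U. - gauss \<psi> quad_char * C \<rho> * \<psi> (?u * x - (\<rho> + 4 * w) * (\<rho> + 4 * w) / (4 * \<rho>)))"
    proof (rule sum.cong[OF refl])
      fix \<rho> assume "\<rho> \<in> ?U"
      then have \<rho>: "\<rho> \<noteq> 0" by simp
      have "\<psi> (?u * x - (\<rho> + 4 * w) * (\<rho> + 4 * w) / (4 * \<rho>)) = \<psi> (?u * x) * \<psi> (- ((\<rho> + 4 * w) * (\<rho> + 4 * w) / (4 * \<rho>)))"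
        by (simp only: psi_add[symmetric]) simp
      then show "char_inv \<beta> \<rho> * \<psi> (?u * x) * (\<Sum>t\<in>UNIV. \<psi> (\<rho> * (t * t) + (\<rho> + 4 * w) * t))
          = - gauss \<psi> quad_char * C \<rho> * \<psi> (?u * x - (\<rho> + 4 * w) * (\<rho> + 4 * w) / (4 * \<rho>))"
        by (simp only: sum_psi_quadratic[OF two \<rho>]) (simp add: C_def char_mult_def)
    qed
    \<comment> \<open>The substitution \<rho> = -4v turns -(\<rho> + 4w)^2/(4\<rho>) into (w -
      v)^2/v and accounts for the constant C(-4).\<close>
    also have "\<dots> = (\<Sum>v\<in>?U. - gauss \<psi> quad_char * C (- 4 * v) * \<psi> (?u * x - (- 4 * v + 4 * w) * (- 4 * v + 4 * w) / (4 * (- 4 * v))))"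
      by (rule sum_units_mult[symmetric]) (use four in simp)
    also have "\<dots> = (\<Sum>v\<in>?U. - C (- 4) * gauss \<psi> quad_char * (C v * \<psi> ((x + v) * (1 + x * y^2 / v))))"
    proof (rule sum.cong[OF refl])
      fix v assume "v \<in> ?U"
      then have v: "v \<noteq> 0" by simp
      have "(- 4 * v + 4 * w) * (- 4 * v + 4 * w) / (4 * (- 4 * v)) = (4 * 4) * ((w - v) * (w - v)) / ((4 * 4) * (- v))"
        by (simp add: algebra_simps)
      also have "\<dots> = (w - v) * (w - v) / (- v)"
        by (intro nonzero_mult_divide_mult_cancel_left) (simp only: mult_eq_0_iff four, simp)
      finally have "?u * x - (- 4 * v + 4 * w) * (- 4 * v + 4 * w) / (4 * (- 4 * v)) = ?u * x + (w - v) * (w - v) / v"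
        by simp
      also have "\<dots> = (x + v) * (1 + x * y^2 / v)"
      proof -
        \<comment> \<open>The cross term -2w = -2xy cancels the middle term of (1 + y)^2 x; this is
          what makes the exponent factor.\<close>
        have "?u * x + (w - v) * (w - v) / v = ?u * x + w * w / v - 2 * w + v"
          using v by (simp add: add_divide_distrib diff_divide_distrib left_diff_distrib right_diff_distrib)
        also have "\<dots> = x + v + x * y^2 + x * (x * y^2) / v"
        proof -
          have "(1 + y)^2 * x + c - 2 * (x * y) + v = x + v + x * y^2 + c" for c
            by (simp add: power2_eq_square algebra_simps)
          moreover have "w * w = x * (x * y^2)"
            by (simp add: w_def power2_eq_square ac_simps)
          ultimately show ?thesis by (simp only: w_def)
        qed
        also have "\<dots> = (x + v) * (1 + x * y^2 / v)"
          using v by (simp add: distrib_left distrib_right add_divide_distrib)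
        finally show ?thesis .
      qed
      finally show "- gauss \<psi> quad_char * C (- 4 * v) * \<psi> (?u * x - (- 4 * v + 4 * w) * (- 4 * v + 4 * w) / (4 * (- 4 * v)))
          = - C (- 4) * gauss \<psi> quad_char * (C v * \<psi> ((x + v) * (1 + x * y^2 / v)))"
        by (simp only: mult_charsD(4)[OF C]) simp
    qed
    finally show ?thesis by (simp only: sum_distrib_left)
  qed
  have "gauss_kernel A \<beta> (char_inv (char_mult \<beta> \<beta>)) (4 * y / ?u)
    = (\<Sum>x\<in>?U. \<Sum>x2\<in>?U. \<Sum>x3\<in>?U. A (?u * x) * \<beta> x2 * char_inv (char_mult \<beta> \<beta>) x3
        * \<psi> (?u * x + x2 + x3 + ?u * x * x2 * (4 * y / ?u) / x3))"
    unfolding gauss_kernel_def by (rule sum_units_mult[OF u, symmetric])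
  also have "\<dots> = (\<Sum>x\<in>?U. A ?u * A x * (\<Sum>x2\<in>?U. \<Sum>x3\<in>?U. \<beta> x2 * char_inv (char_mult \<beta> \<beta>) x3
        * \<psi> (?u * x + x2 + x3 + 4 * x * y * x2 / x3)))"
    unfolding sum_distrib_left
  proof (intro sum.cong refl)
    fix x x2 x3 :: 'a
    have arg: "?u * x * x2 * (4 * y / ?u) / x3 = 4 * x * y * x2 / x3"
    proof -
      have "?u * x * x2 * (4 * y / ?u) = ?u * (x * x2 * (4 * y)) / ?u" by (simp only: times_divide_eq_right mult.assoc)
      also have "\<dots> = 4 * x * y * x2" unfolding nonzero_mult_div_cancel_left[OF u] by (simp only: ac_simps)
      finally show ?thesis by (simp only:)
    qed
    show "A (?u * x) * \<beta> x2 * char_inv (char_mult \<beta> \<beta>) x3 * \<psi> (?u * x + x2 + x3 + ?u * x * x2 * (4 * y / ?u) / x3)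
      = A ?u * A x * (\<beta> x2 * char_inv (char_mult \<beta> \<beta>) x3 * \<psi> (?u * x + x2 + x3 + 4 * x * y * x2 / x3))"
      unfolding arg mult_charsD(4)[OF A] by (simp only: mult.assoc)
  qed
  also have "\<dots> = - A ?u * C (- 4) * gauss \<psi> quad_char * bilinear_sum A C (y^2)"
    unfolding inner bilinear_sum_def sum_distrib_left
    by (intro sum.cong refl) (simp only: mult_minus_left mult_minus_right ac_simps)
  finally show ?thesis by (simp only: C_def)
qed

end

section \<open>The quadratic transformation in one variable\<close>

text \<open>Analogue of the classical 2F1(a, a-b+1/2; b+1/2; y^2) = (1+y)^(-2a) 2F1(a, b; 2b;
  4y/(1+y)^2), with \<open>quad_char\<close> in the role of 1/2. The Pochhammer quotients are
  cleared of the factors common to both sides.\<close>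

lemma (in nontriv_additive_character) hypergeometric_quadratic_transformation:
  assumes two: "(2::'a) \<noteq> 0" and A: "A \<in> mult_chars"
    and \<beta>: "\<beta> \<in> mult_chars" "char_mult \<beta> \<beta> \<noteq> triv_char"
    and y: "y \<noteq> 0" "y \<noteq> 1" "y \<noteq> - 1"
    and B: "B = char_mult A (char_mult (char_inv \<beta>) quad_char)"
  shows "gauss0 \<psi> (char_mult \<beta> quad_char) * (\<Sum>\<nu>\<in>mult_chars. gauss \<psi> (char_mult A \<nu>) * gauss \<psi> (char_mult B \<nu>)
      / (gauss0 \<psi> (char_mult (char_mult \<beta> quad_char) \<nu>) * gauss0 \<psi> \<nu>) * \<nu> (y^2))
    = inverse (A ((1 + y)^2)) * (gauss \<psi> B * gauss0 \<psi> (char_mult \<beta> \<beta>) / gauss \<psi> \<beta>)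
      * (\<Sum>\<nu>\<in>mult_chars. gauss \<psi> (char_mult A \<nu>) * gauss \<psi> (char_mult \<beta> \<nu>)
      / (gauss0 \<psi> (char_mult (char_mult \<beta> \<beta>) \<nu>) * gauss0 \<psi> \<nu>) * \<nu> (4 * y / (1 + y)^2))"
proof -
  let ?C = "char_mult (char_inv \<beta>) quad_char" and ?N = "of_nat (card (mult_chars :: ('a \<Rightarrow> complex) set)) :: complex"
    and ?q = "of_nat (card (UNIV :: 'a set)) :: complex" and ?u = "(1 + y)^2"
  have C: "?C \<in> mult_chars" by (intro char_mult_mem char_inv_mem \<beta> quad_char_mem)
  have four: "(4::'a) \<noteq> 0"
    by (rule four_nonzero[OF two])
  have y1: "1 + y \<noteq> 0" using y(3) by (simp add: eq_neg_iff_add_eq_0 add.commute)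
  \<comment> \<open>Nonzero arguments are required for orthogonality, and y^2 \<noteq> 1 for the
    Kloosterman step.\<close>
  have z: "y^2 \<noteq> 0" "y^2 \<noteq> 1" "4 * y / ?u \<noteq> 0"
    using y y1 four by (simp_all add: power2_eq_1_iff)
  note nt = nontriv_if_square_nontriv[OF \<beta>]
  have inv: "char_inv (char_mult \<beta> quad_char) = ?C"
    by (auto simp: char_inv_def char_mult_def quad_char_def)
  \<comment> \<open>Here 4 is a square and \<beta>(-1) is its own inverse. The resulting sign agrees
    with the one that reflection produces on the other side, so only 1/\<beta>(4) has to be
    accounted for.\<close>
  have C4: "?C (- 4) = \<beta> (- 1) * quad_char (- 1 :: 'a) * inverse (\<beta> 4)"
  proof -
    have "quad_char (4::'a) = 1" using four by (auto simp: quad_char_def intro!: exI[of _ 2])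
    moreover have "inverse (\<beta> (- 1)) = \<beta> (- 1)"
      using mult_char_minus_one_square[OF \<beta>(1)] by (rule inverse_unique)
    ultimately have "?C 4 = inverse (\<beta> 4)" "?C (- 1) = \<beta> (- 1) * quad_char (- 1 :: 'a)"
      by (simp_all add: char_mult_def char_inv_eq[OF \<beta>(1)])
    then show ?thesis using mult_charsD(4)[OF C, of "- 1" 4] by simp
  qed
  have L: "(\<Sum>\<nu>\<in>mult_chars. gauss \<psi> (char_mult A \<nu>) * gauss \<psi> (char_mult B \<nu>)
      / (gauss0 \<psi> (char_mult (char_mult \<beta> quad_char) \<nu>) * gauss0 \<psi> \<nu>) * \<nu> (y^2))
    = ?N / ?q^2 * (\<beta> (- 1) * quad_char (- 1 :: 'a)) * (- gauss \<psi> B * bilinear_sum A ?C (y^2))"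
    using sum_mult_chars_gauss0[OF char_mult_mem[OF \<beta>(1) quad_char_mem] z(1), of A B]
    unfolding inv B gauss_kernel_char_mult[OF A C z(2)] by (simp only: char_mult_def)
  have "char_mult \<beta> \<beta> (- 1) = 1" unfolding char_mult_def by (rule mult_char_minus_one_square[OF \<beta>(1)])
  then have R: "(\<Sum>\<nu>\<in>mult_chars. gauss \<psi> (char_mult A \<nu>) * gauss \<psi> (char_mult \<beta> \<nu>)
      / (gauss0 \<psi> (char_mult (char_mult \<beta> \<beta>) \<nu>) * gauss0 \<psi> \<nu>) * \<nu> (4 * y / ?u))
    = ?N / ?q^2 * (- A ?u * (\<beta> (- 1) * quad_char (- 1 :: 'a) * inverse (\<beta> 4)) * gauss \<psi> quad_char * bilinear_sum A ?C (y^2))"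
    using sum_mult_chars_gauss0[OF char_mult_mem[OF \<beta>(1) \<beta>(1)] z(3), of A \<beta>]
    unfolding gauss_kernel_square[OF two A \<beta>(1) nt(1) y1] C4 by simp
  \<comment> \<open>This supplies both the Gauss sum of \<open>quad_char\<close> and the factor
    1/\<beta>(4) by which the two sides still differ.\<close>
  have hd: "gauss \<psi> (char_mult \<beta> quad_char) = gauss \<psi> (char_mult \<beta> \<beta>) * gauss \<psi> quad_char / (\<beta> 4 * gauss \<psi> \<beta>)"
    using hasse_davenport_2[OF two \<beta>] gauss_nonzero[OF \<beta>(1)] mult_charsD(2)[OF \<beta>(1) four]
    by (simp add: field_simps)
  have g0: "gauss0 \<psi> (char_mult \<beta> quad_char) = gauss \<psi> (char_mult \<beta> quad_char)"
    "gauss0 \<psi> (char_mult \<beta> \<beta>) = gauss \<psi> (char_mult \<beta> \<beta>)"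
    using \<beta>(2) nt(2) by (simp_all add: gauss0_def)
  have "A ?u \<noteq> 0" using mult_charsD(2)[OF A] y1 by simp
  then show ?thesis
    unfolding L R g0 hd by (simp add: field_simps)
qed

section \<open>From the one-variable identity to the Appell functions\<close>

theorem theorem3p18:
  fixes \<psi> \<alpha> \<beta> \<gamma> :: "'a::{finite,field} \<Rightarrow> complex"
    and x y :: 'a
  assumes "CHAR('a) \<noteq> 2"
    and "nontriv_add_char \<psi>"
    and "\<alpha> \<in> mult_chars" and "\<beta> \<in> mult_chars" and "\<gamma> \<in> mult_chars"
    and "char_mult \<beta> \<beta> \<noteq> triv_char"
    and "y \<noteq> 1" and "y \<noteq> -1"
  shows "appellF4 \<psi> \<alpha> (char_mult (char_mult \<alpha> (char_inv \<beta>)) quad_char) \<gamma> (char_mult \<beta> quad_char) x (y^2)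
       = (char_inv \<alpha> (1 + y))^2 *
         appellF2 \<psi> \<alpha> (char_mult (char_mult \<alpha> (char_inv \<beta>)) quad_char) \<beta> \<gamma> (char_mult \<beta> \<beta>)
           (x / (1 + y)^2) (4 * y / (1 + y)^2)"
proof (cases "y = 0")
  \<comment> \<open>Every character, including the trivial one, is 0 at 0, so both double sums
    vanish.\<close>
  case True
  then show ?thesis by (simp add: appellF4_def appellF2_def mult_charsD(1))
next
  case y0: False
  interpret nontriv_additive_character \<psi> by unfold_locales (rule assms(2))
  have two: "(2::'a) \<noteq> 0" using assms(1) CHAR_neq_2_iff by blast
  let ?B = "char_mult (char_mult \<alpha> (char_inv \<beta>)) quad_char" and ?u = "(1 + y)^2"
  let ?s4 = "\<lambda>\<nu>1. \<Sum>\<nu>2\<in>mult_chars. poch \<psi> \<alpha> (char_mult \<nu>1 \<nu>2) * poch \<psi> ?B (char_mult \<nu>1 \<nu>2)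
        / (poch0 \<psi> \<gamma> \<nu>1 * poch0 \<psi> (char_mult \<beta> quad_char) \<nu>2 * poch0 \<psi> triv_char \<nu>1 * poch0 \<psi> triv_char \<nu>2)
        * \<nu>1 x * \<nu>2 (y^2)"
  let ?s2 = "\<lambda>\<nu>1. \<Sum>\<nu>2\<in>mult_chars. poch \<psi> \<alpha> (char_mult \<nu>1 \<nu>2) * poch \<psi> ?B \<nu>1 * poch \<psi> \<beta> \<nu>2
        / (poch0 \<psi> \<gamma> \<nu>1 * poch0 \<psi> (char_mult \<beta> \<beta>) \<nu>2 * poch0 \<psi> triv_char \<nu>1 * poch0 \<psi> triv_char \<nu>2)
        * \<nu>1 (x / ?u) * \<nu>2 (4 * y / ?u)"
  \<comment> \<open>The identity holds separately for each value of the first character.\<close>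
  have "?s4 \<nu> = (char_inv \<alpha> (1 + y))^2 * ?s2 \<nu>" if \<nu>: "\<nu> \<in> mult_chars" for \<nu>
  proof -
    define A where "A = char_mult \<alpha> \<nu>"
    define B where "B = char_mult ?B \<nu>"
    \<comment> \<open>\<open>r\<close> collects the factors free of the second character that both
      sides share.\<close>
    define r where "r = gauss0 \<psi> triv_char / (gauss \<psi> \<alpha> * gauss \<psi> ?B * poch0 \<psi> \<gamma> \<nu> * poch0 \<psi> triv_char \<nu>)"
    have A: "A \<in> mult_chars" unfolding A_def by (rule char_mult_mem[OF assms(3) \<nu>])
    have B: "B = char_mult A (char_mult (char_inv \<beta>) quad_char)"
      by (simp add: A_def B_def char_mult_def ac_simps)
    have assoc: "char_mult \<alpha> (char_mult \<nu> \<mu>) = char_mult A \<mu>" "char_mult ?B (char_mult \<nu> \<mu>) = char_mult B \<mu>" for \<mu>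
      by (simp_all only: A_def B_def char_mult_assoc)
    have triv: "char_mult triv_char \<mu> = \<mu>" if "\<mu> \<in> mult_chars" for \<mu> :: "'a \<Rightarrow> complex"
      using char_mult_triv[OF that] by (simp only: char_mult_commute)
    have "?s4 \<nu> = (\<Sum>\<mu>\<in>mult_chars. \<nu> x * r * (gauss0 \<psi> (char_mult \<beta> quad_char) *
        (gauss \<psi> (char_mult A \<mu>) * gauss \<psi> (char_mult B \<mu>)
         / (gauss0 \<psi> (char_mult (char_mult \<beta> quad_char) \<mu>) * gauss0 \<psi> \<mu>) * \<mu> (y^2))))"
    proof (rule sum.cong[OF refl])
      fix \<mu> :: "'a \<Rightarrow> complex" assume "\<mu> \<in> mult_chars"
      \<comment> \<open>A formal rearrangement, valid even for zero denominators because
        \<open>inverse\<close> is multiplicative at 0 as well.\<close>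
      have "a / ga * (b / gb) / (P * (c / gc) * Q * (d / gd)) * s * t = s * (gd / (ga * gb * P * Q)) * (gc * (a * b / (c * d) * t))"
        for a b c d ga gb gc gd P Q s t :: complex
        by (simp add: field_class.field_divide_inverse ac_simps)
      then show "poch \<psi> \<alpha> (char_mult \<nu> \<mu>) * poch \<psi> ?B (char_mult \<nu> \<mu>)
          / (poch0 \<psi> \<gamma> \<nu> * poch0 \<psi> (char_mult \<beta> quad_char) \<mu> * poch0 \<psi> triv_char \<nu> * poch0 \<psi> triv_char \<mu>)
          * \<nu> x * \<mu> (y^2) = \<nu> x * r * (gauss0 \<psi> (char_mult \<beta> quad_char) *
        (gauss \<psi> (char_mult A \<mu>) * gauss \<psi> (char_mult B \<mu>)
         / (gauss0 \<psi> (char_mult (char_mult \<beta> quad_char) \<mu>) * gauss0 \<psi> \<mu>) * \<mu> (y^2)))"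
        unfolding r_def poch_def[of \<psi> \<alpha>] poch_def[of \<psi> ?B] poch0_def[of \<psi> "char_mult \<beta> quad_char"]
          poch0_def[of \<psi> triv_char \<mu>] assoc triv[OF \<open>\<mu> \<in> mult_chars\<close>] by blast
    qed
    also have "\<dots> = \<nu> x * r * (inverse (A ?u) * (gauss \<psi> B * gauss0 \<psi> (char_mult \<beta> \<beta>) / gauss \<psi> \<beta>)
      * (\<Sum>\<mu>\<in>mult_chars. gauss \<psi> (char_mult A \<mu>) * gauss \<psi> (char_mult \<beta> \<mu>)
      / (gauss0 \<psi> (char_mult (char_mult \<beta> \<beta>) \<mu>) * gauss0 \<psi> \<mu>) * \<mu> (4 * y / ?u)))"
      unfolding sum_distrib_left[symmetric]
      by (simp only: hypergeometric_quadratic_transformation[OF two A assms(4,6) y0 assms(7,8) B])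
    also have "\<dots> = (char_inv \<alpha> (1 + y))^2 * (\<Sum>\<mu>\<in>mult_chars. \<nu> (x / ?u) * r * (gauss \<psi> B * gauss0 \<psi> (char_mult \<beta> \<beta>) / gauss \<psi> \<beta>
      * (gauss \<psi> (char_mult A \<mu>) * gauss \<psi> (char_mult \<beta> \<mu>)
      / (gauss0 \<psi> (char_mult (char_mult \<beta> \<beta>) \<mu>) * gauss0 \<psi> \<mu>) * \<mu> (4 * y / ?u))))"
    proof -
      \<comment> \<open>As A = \<alpha>\<nu>, the \<alpha> part gives the prefactor, while the \<nu>
        part rescales x to x/(1 + y)^2.\<close>
      have "\<nu> x * inverse (A ?u) = (char_inv \<alpha> (1 + y))^2 * \<nu> (x / ?u)"
        by (simp add: A_def char_mult_def char_inv_eq[OF assms(3)] mult_char_divide[OF \<nu>]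
            mult_char_power[OF assms(3)] mult_char_power[OF \<nu>] power_inverse)
           (simp add: field_class.field_divide_inverse)
      then have "\<nu> x * s * (inverse (A ?u) * t * w) = (char_inv \<alpha> (1 + y))^2 * (\<nu> (x / ?u) * s * (t * w))" for s t w
        by (metis (no_types, opaque_lifting) mult.assoc mult.commute)
      then show ?thesis unfolding sum_distrib_left[symmetric] by blast
    qed
    also have "(\<Sum>\<mu>\<in>mult_chars. \<nu> (x / ?u) * r * (gauss \<psi> B * gauss0 \<psi> (char_mult \<beta> \<beta>) / gauss \<psi> \<beta>
      * (gauss \<psi> (char_mult A \<mu>) * gauss \<psi> (char_mult \<beta> \<mu>)
      / (gauss0 \<psi> (char_mult (char_mult \<beta> \<beta>) \<mu>) * gauss0 \<psi> \<mu>) * \<mu> (4 * y / ?u)))) = ?s2 \<nu>"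
    proof (rule sum.cong[OF refl])
      fix \<mu> :: "'a \<Rightarrow> complex" assume "\<mu> \<in> mult_chars"
      have "s * (gd / (ga * gb * P * Q)) * (b * gc / ge * (a * e / (c * d) * t))
          = a / ga * (b / gb) * (e / ge) / (P * (c / gc) * Q * (d / gd)) * s * t"
        for a b c d e ga gb gc gd ge P Q s t :: complex
        by (simp add: field_class.field_divide_inverse ac_simps)
      then show "\<nu> (x / ?u) * r * (gauss \<psi> B * gauss0 \<psi> (char_mult \<beta> \<beta>) / gauss \<psi> \<beta>
          * (gauss \<psi> (char_mult A \<mu>) * gauss \<psi> (char_mult \<beta> \<mu>)
          / (gauss0 \<psi> (char_mult (char_mult \<beta> \<beta>) \<mu>) * gauss0 \<psi> \<mu>) * \<mu> (4 * y / ?u)))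
        = poch \<psi> \<alpha> (char_mult \<nu> \<mu>) * poch \<psi> ?B \<nu> * poch \<psi> \<beta> \<mu>
          / (poch0 \<psi> \<gamma> \<nu> * poch0 \<psi> (char_mult \<beta> \<beta>) \<mu> * poch0 \<psi> triv_char \<nu> * poch0 \<psi> triv_char \<mu>)
          * \<nu> (x / ?u) * \<mu> (4 * y / ?u)"
        unfolding r_def poch_def[of \<psi> \<alpha>] poch_def[of \<psi> ?B] poch_def[of \<psi> \<beta>] poch0_def[of \<psi> "char_mult \<beta> \<beta>"]
          poch0_def[of \<psi> triv_char \<mu>] assoc triv[OF \<open>\<mu> \<in> mult_chars\<close>] B_def[symmetric] by blast
    qed
    finally show ?thesis .
  qed
  then have "(\<Sum>\<nu>\<in>mult_chars. ?s4 \<nu>) = (char_inv \<alpha> (1 + y))^2 * (\<Sum>\<nu>\<in>mult_chars. ?s2 \<nu>)"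
    unfolding sum_distrib_left by (rule sum.cong[OF refl])
  then show ?thesis
    unfolding appellF4_def appellF2_def by (simp only: mult.left_commute)
qed

end
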